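(* Let $p$ be a prime, $k$ a field of characteristic $p$, $\gamma\in k$ a root of unity of order $q$, and $g(\zeta)=\gamma\zeta+\cdots$ a power series in $k[[\zeta]]$. If $p$ is odd, then $g$ is minimally ramified if and only if $i_0(g^q)=q$ and $\mathrm{resit}(g)\ne0$. If $p=2$, then $g$ is minimally ramified if and only if $i_0(g^q)=q$, $\mathrm{resit}(g)\ne0$ and $\mathrm{resit}(g)\ne1$.
   Context: $\mathrm{ord}$ is the lowest degree of a nonzero term in $k[[\zeta]]$; for $h(\zeta)=\zeta+\cdots$, $i_n(h)=\mathrm{ord}\big((h^{p^n}(\zeta)-\zeta)/\zeta\big)$ (compositional iterates). $g$ is minimally ramified if $i_n(g^q)=q\frac{p^{n+1}-1}{p-1}$ for all $n\ge0$. Two power series $g,\hat g$ with zero constant term and nonzero linear coefficient are conjugated if $\hat g=h\circ g\circ h^{-1}$ for some such power series $h$. Every $g(\zeta)=\gamma\zeta+\cdots$ is conjugated to a power series $\hat g(\zeta)=\gamma\zeta\big(1+\sum_{j\ge1}a_j\zeta^{jq}\big)$ (for $q=1$ one may take $\hat g=g$), one has $a_1\ne0$ iff $i_0(g^q)=q$, and in this case $a_2/a_1^2$ depends only on $g$. When $i_0(g^q)=q$, the iterative residue is $\mathrm{resit}(g)=\frac{q+1}{2}-\frac{a_2}{a_1^2}\in k$ (when $p=2$, $q$ is odd, so $\frac{q+1}{2}$ is an integer). *)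

theory Defs
  imports "HOL-Computational_Algebra.Formal_Power_Series" "HOL-Library.Extended_Nat"
begin

definition fps_iter :: "'a::field fps \<Rightarrow> nat \<Rightarrow> 'a fps" where
  "fps_iter h n = ((\<lambda>f. h oo f) ^^ n) fps_X"

definition ram_index :: "nat \<Rightarrow> 'a::field fps \<Rightarrow> enat" where
  "ram_index n h =
     (let d = (fps_iter h (CHAR('a) ^ n) - fps_X) / fps_X
      in if d = 0 then \<infinity> else enat (subdegree d))"

definition minimally_ramified :: "nat \<Rightarrow> 'a::field fps \<Rightarrow> bool" where
  "minimally_ramified q g \<longleftrightarrow>
     (\<forall>n. ram_index n (fps_iter g q) =
          enat (q * ((CHAR('a) ^ (n + 1) - 1) div (CHAR('a) - 1))))"

definition fps_invertible_series :: "'a::field fps \<Rightarrow> bool" where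
  "fps_invertible_series h \<longleftrightarrow> fps_nth h 0 = 0 \<and> fps_nth h 1 \<noteq> 0"

definition fps_conjugated :: "'a::field fps \<Rightarrow> 'a fps \<Rightarrow> bool" where
  "fps_conjugated g g' \<longleftrightarrow>
     (\<exists>h. fps_invertible_series h \<and> g' = (h oo g) oo fps_inv h)"

text \<open>g' = gamma*zeta*(1 + sum_{j>=1} a_j zeta^(jq)), i.e. g'_0 = 0, g'_1 = gamma,
  and g'_m = 0 unless m = jq+1; then a_j = g'_{jq+1} / gamma.\<close>
definition normal_form :: "nat \<Rightarrow> 'a::field \<Rightarrow> 'a fps \<Rightarrow> bool" where
  "normal_form q \<gamma> g' \<longleftrightarrow>
     fps_nth g' 0 = 0 \<and> fps_nth g' 1 = \<gamma> \<and>
     (\<forall>m. (\<not> (\<exists>j. m = j * q + 1)) \<longrightarrow> fps_nth g' m = 0)"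

definition nf_coeff :: "nat \<Rightarrow> 'a::field fps \<Rightarrow> nat \<Rightarrow> 'a" where
  "nf_coeff q g' j = fps_nth g' (j * q + 1) / fps_nth g' 1"

text \<open>(q+1)/2 in k; for characteristic 2 (q odd) it is the integer (q+1) div 2.\<close>
definition half_q_plus_1 :: "nat \<Rightarrow> 'a::field" where
  "half_q_plus_1 q = (if CHAR('a) = 2 then of_nat ((q + 1) div 2) else of_nat (q + 1) / 2)"

definition resit :: "nat \<Rightarrow> 'a::field fps \<Rightarrow> 'a" where
  "resit q g = (SOME r. \<exists>g'. fps_conjugated g g' \<and> normal_form q (fps_nth g 1) g' \<and>
        nf_coeff q g' 1 \<noteq> 0 \<and>
        r = half_q_plus_1 q - nf_coeff q g' 2 / (nf_coeff q g' 1)^2)"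

end

theory Submission
  imports Defs "HOL-Number_Theory.Cong"
begin

text \<open>
  Let $T\varphi = \varphi \circ f - \varphi$ for $f = g^q$, where \<open>g\<close> is in normal form. In
  characteristic \<open>p\<close> one has $f^p - \zeta = T^p \zeta$, so the leading term of $f^p - \zeta$ is
  found by applying \<open>T\<close> to two-term expansions. If
  $F = f^{p^n} = \zeta + \chi \zeta^{N+1} + \xi \zeta^{N+q+1} + \cdots$ with
  $N = q (p^{n+1}-1)/(p-1)$ and $\chi \neq 0$, then the coefficient of $F^p - \zeta$ in degree
  $pN + 1$ vanishes and the one in degree $pN + q + 1$ is, for $n \geq 1$, a nonzero multiple of
  $\chi^{p-1} \xi$. Since \<open>F\<close> commutes with \<open>f\<close>, the ratio $\xi / \chi$ is determined by the
  first two coefficients of \<open>f\<close>: up to a nonzero factor it is $\mathrm{resit}(g)$ for odd \<open>p\<close>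
  and $\mathrm{resit}(g) - 1$ for $p = 2$. The step from $n = 0$ to $n = 1$ involves in addition
  the square of the leading term and yields $\mathrm{resit}(g)$ in all characteristics.
\<close>

section \<open>Congruences modulo powers of \<open>fps_X\<close>\<close>

lemma fps_X_power_dvd_iff:
  "fps_X ^ k dvd (f :: 'a::field fps) \<longleftrightarrow> (\<forall>i<k. fps_nth f i = 0)"
proof (cases "f = 0")
  case False
  have "k \<le> subdegree f \<longleftrightarrow> (\<forall>i<k. fps_nth f i = 0)"
    using False by (meson le_less_trans linorder_not_less nth_less_subdegree_zero nth_subdegree_nonzero order.strict_trans2)
  with False show ?thesis by (simp add: fps_dvd_iff)
qed auto

lemma fps_X_power_dvd_compose:
  fixes f :: "'a::field fps"
  assumes "fps_X ^ k dvd \<phi>" "fps_nth f 0 = 0"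
  shows "fps_X ^ k dvd \<phi> oo f"
proof -
  from assms(1) obtain \<psi> where "\<phi> = fps_X ^ k * \<psi>" by (elim dvdE)
  then have "\<phi> oo f = f ^ k * (\<psi> oo f)"
    using assms(2) by (simp add: fps_compose_mult_distrib fps_X_power_compose)
  moreover have "fps_X ^ 1 dvd f" using assms(2) by (simp only: fps_X_power_dvd_iff) simp
  then have "fps_X ^ k dvd f ^ k" by (simp add: dvd_power_same)
  ultimately show ?thesis by simp
qed

text \<open>\<open>f - g\<close> divides \<open>f ^ i - g ^ i\<close>, and each coefficient of a
  composition is a finite combination of coefficients of such powers.\<close>

lemma fps_X_power_dvd_compose_diff:
  fixes f g :: "'a::field fps"
  assumes "fps_X ^ k dvd f - g"
  shows "fps_X ^ k dvd (\<phi> oo f) - (\<phi> oo g)"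
proof -
  have "fps_nth (f ^ i - g ^ i) n = 0" if "n < k" for i n
  proof -
    have "fps_X ^ k dvd f ^ i - g ^ i"
      using assms by (subst power_diff_sumr2) (rule dvd_mult2)
    with that show ?thesis by (simp only: fps_X_power_dvd_iff)
  qed
  then show ?thesis
    by (simp add: fps_X_power_dvd_iff fps_compose_nth sum_subtractf[symmetric]
        right_diff_distrib[symmetric])
qed

text \<open>Second order suffices later: with \<open>z\<close> divisible by \<open>fps_X ^ N\<close>
  and 0 < q <= N, the cubic remainder starts in degree 3N > N + q.\<close>

lemma power_one_plus_expansion:
  fixes z :: "'a::comm_ring_1"
  shows "z ^ 3 dvd (1 + z) ^ m - 1 - of_nat m * z - of_nat (m choose 2) * z ^ 2"
proof (induction m)
  case (Suc m)
  have 1: "of_nat (Suc m choose 2) = (of_nat m + of_nat (m choose 2) :: 'a)"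
    by (simp add: numeral_2_eq_2)
  have "(1 + z) ^ Suc m - 1 - of_nat (Suc m) * z - of_nat (Suc m choose 2) * z ^ 2
      = (1 + z) * ((1 + z) ^ m - 1 - of_nat m * z - of_nat (m choose 2) * z ^ 2)
        + of_nat (m choose 2) * z ^ 3"
    unfolding 1 by (simp add: algebra_simps power2_eq_square power3_eq_cube)
  with Suc.IH show ?case by simp
qed (simp add: numeral_2_eq_2)

section \<open>Compositional iterates\<close>

lemma fps_iter_0 [simp]: "fps_iter h 0 = fps_X"
  by (simp add: fps_iter_def)

lemma fps_iter_Suc: "fps_iter h (Suc n) = h oo fps_iter h n"
  by (simp add: fps_iter_def)

lemma fps_iter_nth_0 [simp]: "fps_nth h 0 = 0 \<Longrightarrow> fps_nth (fps_iter h n) 0 = 0"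
  by (induction n) (simp_all add: fps_iter_Suc)

lemma fps_iter_1: "fps_nth h 0 = 0 \<Longrightarrow> fps_iter h 1 = h"
  by (simp add: fps_iter_Suc)

lemma fps_iter_add:
  assumes "fps_nth h 0 = 0"
  shows "fps_iter h (m + n) = fps_iter h m oo fps_iter h n"
  using assms by (induction m) (simp_all add: fps_iter_Suc fps_compose_assoc)

lemma fps_iter_mult:
  assumes "fps_nth h 0 = 0"
  shows "fps_iter h (m * n) = fps_iter (fps_iter h m) n"
proof (induction n)
  case (Suc n)
  then show ?case using assms fps_iter_add[OF assms, of m "m * n"] by (simp add: fps_iter_Suc)
qed simp

lemma fps_iter_commute:
  assumes "fps_nth h 0 = 0"
  shows "fps_iter h m oo fps_iter h n = fps_iter h n oo fps_iter h m"
  using fps_iter_add[OF assms] by (metis add.commute)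

lemma fps_iter_Suc_right:
  assumes "fps_nth h 0 = 0"
  shows "fps_iter h (Suc n) = fps_iter h n oo h"
  using fps_iter_add[OF assms, of n 1] unfolding fps_iter_1[OF assms] by simp

lemma fps_iter_conj:
  fixes g h k :: "'a::field fps"
  assumes "fps_nth g 0 = 0" "fps_nth h 0 = 0" "fps_nth k 0 = 0"
    and "k oo h = fps_X" "h oo k = fps_X"
  shows "fps_iter ((h oo g) oo k) n = (h oo fps_iter g n) oo k"
proof (induction n)
  case (Suc n)
  have "fps_iter ((h oo g) oo k) (Suc n) = ((h oo g) oo (k oo h)) oo (fps_iter g n oo k)"
    using assms(1-3) by (simp add: fps_iter_Suc Suc fps_compose_assoc)
  also have "\<dots> = (h oo fps_iter g (Suc n)) oo k"
    using assms(1-3) by (simp add: assms(4) fps_iter_Suc fps_compose_assoc)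
  finally show ?case .
qed (use assms in simp)

section \<open>The difference operator and the p-th iterate\<close>

definition compose_diff :: "'a::field fps \<Rightarrow> 'a fps \<Rightarrow> 'a fps" where
  "compose_diff f \<phi> = (\<phi> oo f) - \<phi>"

lemma compose_diff_add: "compose_diff f (\<phi> + \<psi>) = compose_diff f \<phi> + compose_diff f \<psi>"
  by (simp add: compose_diff_def fps_compose_add_distrib)

lemma compose_diff_const_mult:
  "compose_diff f (fps_const c * \<phi>) = fps_const c * compose_diff f \<phi>"
  by (simp add: compose_diff_def fps_const_mult_apply_left[symmetric] right_diff_distrib)

text \<open>Composition with \<open>f\<close> is the linear operator 1 + T with T =
  \<open>compose_diff f\<close>; this is the binomial theorem for its n-th power.\<close>

lemma compose_fps_iter_eq_sum:
  fixes f \<phi> :: "'a::field fps"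
  assumes "fps_nth f 0 = 0"
  shows "\<phi> oo fps_iter f n =
    (\<Sum>i\<le>n. of_nat (n choose i) * (compose_diff f ^^ i) \<phi>)"
proof (induction n arbitrary: \<phi>)
  case (Suc n)
  let ?T = "\<lambda>i. (compose_diff f ^^ i) \<phi>"
  have "\<phi> oo fps_iter f (Suc n) = (\<phi> oo f) oo fps_iter f n"
    using assms by (simp add: fps_iter_Suc fps_compose_assoc)
  also have "\<phi> oo f = \<phi> + compose_diff f \<phi>" by (simp add: compose_diff_def)
  also have "(\<phi> + compose_diff f \<phi>) oo fps_iter f n =
      (\<Sum>i\<le>n. of_nat (n choose i) * ?T i) + (\<Sum>i\<le>n. of_nat (n choose i) * ?T (Suc i))"
    by (simp only: fps_compose_add_distrib) (simp only: Suc.IH funpow_Suc_right o_apply)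
  also have "(\<Sum>i\<le>n. of_nat (n choose i) * ?T i)
      = \<phi> + (\<Sum>i\<le>n. of_nat (n choose Suc i) * ?T (Suc i))"
  proof -
    have "(\<Sum>i\<le>n. of_nat (n choose i) * ?T i) = (\<Sum>i\<le>Suc n. of_nat (n choose i) * ?T i)"
      by (simp add: binomial_eq_0)
    also have "\<dots> = \<phi> + (\<Sum>i\<le>n. of_nat (n choose Suc i) * ?T (Suc i))"
      by (subst sum.atMost_Suc_shift) simp
    finally show ?thesis .
  qed
  also have "\<phi> + (\<Sum>i\<le>n. of_nat (n choose Suc i) * ?T (Suc i))
        + (\<Sum>i\<le>n. of_nat (n choose i) * ?T (Suc i))
      = (\<Sum>i\<le>Suc n. of_nat (Suc n choose i) * ?T i)"
    by (simp only: sum.atMost_Suc_shift binomial_Suc_Suc of_nat_add distrib_right sum.distrib)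
      (simp add: add_ac)
  finally show ?case .
qed simp

text \<open>In characteristic p the binomial coefficients strictly between the two ends vanish, so
  (1 + T)^p = 1 + T^p.\<close>

lemma fps_iter_CHAR:
  fixes f :: "'a::field fps"
  assumes "prime CHAR('a)" "fps_nth f 0 = 0"
  shows "fps_iter f CHAR('a) = fps_X + (compose_diff f ^^ CHAR('a)) fps_X"
proof -
  define p where "p = CHAR('a)"
  have p: "prime p" using assms by (simp add: p_def)
  have z: "of_nat (p choose i) = (0 :: 'a fps)" if "i \<in> {..p} - {0, p}" for i
  proof -
    have "p dvd (p choose i)" using that p by (intro dvd_choose_prime) auto
    then have "of_nat (p choose i) = (0 :: 'a)" by (simp add: p_def of_nat_eq_0_iff_char_dvd)
    then show ?thesis by (metis fps_of_nat fps_const_0_eq_0)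
  qed
  have "fps_iter f p = fps_X oo fps_iter f p" using assms by simp
  also have "\<dots> = (\<Sum>i\<le>p. of_nat (p choose i) * (compose_diff f ^^ i) fps_X)"
    by (rule compose_fps_iter_eq_sum[OF assms(2)])
  also have "\<dots> = (\<Sum>i\<in>{0, p}. of_nat (p choose i) * (compose_diff f ^^ i) fps_X)"
    using z by (intro sum.mono_neutral_right) auto
  also have "\<dots> = fps_X + (compose_diff f ^^ p) fps_X"
    using prime_gt_0_nat[OF p] by simp
  finally show ?thesis by (simp add: p_def)
qed

lemma compose_diff_commute:
  fixes f g :: "'a::field fps"
  assumes "fps_nth f 0 = 0" "fps_nth g 0 = 0" "f oo g = g oo f"
  shows "compose_diff f (compose_diff g \<phi>) = compose_diff g (compose_diff f \<phi>)"
proof -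
  have "(\<phi> oo f) oo g = (\<phi> oo g) oo f"
    using assms by (simp flip: fps_compose_assoc)
  then show ?thesis by (simp add: compose_diff_def fps_compose_sub_distrib)
qed

section \<open>Two-term expansions under the difference operator\<close>

text \<open>The congruence also forces the coefficients strictly between degrees \<open>m\<close>
  and \<open>m + q\<close> to vanish, as happens for series whose exponents are all congruent modulo
  q. Both \<open>u\<close> and \<open>v\<close> may be zero.\<close>

definition two_term :: "nat \<Rightarrow> nat \<Rightarrow> 'a::field \<Rightarrow> 'a \<Rightarrow> 'a fps \<Rightarrow> bool" where
  "two_term q m u v \<phi> \<longleftrightarrow>
     fps_X ^ (m + q + 1) dvd \<phi> - (fps_const u * fps_X ^ m + fps_const v * fps_X ^ (m + q))"

lemma two_term_iff:
  assumes "0 < q"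
  shows "two_term q m u v \<phi> \<longleftrightarrow>
    (\<forall>i\<le>m + q. fps_nth \<phi> i = (if i = m then u else if i = m + q then v else 0))"
proof -
  have "fps_nth (\<phi> - (fps_const u * fps_X ^ m + fps_const v * fps_X ^ (m + q))) i
      = fps_nth \<phi> i - (if i = m then u else if i = m + q then v else 0)" for i
    using assms by (auto simp: fps_X_power_mult_right_nth)
  then show ?thesis
    unfolding two_term_def fps_X_power_dvd_iff
    by (simp only: right_minus_eq less_Suc_eq_le Suc_eq_plus1[symmetric])
qed

text \<open>The second summand comes from $\chi^2 \zeta^{2N}$, which contributes to the order
  considered only if \<open>N = q\<close>.\<close>

definition second_coeff :: "nat \<Rightarrow> nat \<Rightarrow> 'a::field \<Rightarrow> 'a \<Rightarrow> nat \<Rightarrow> 'a" where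
  "second_coeff q N \<chi> \<xi> m =
     of_nat m * \<xi> + (if N = q then of_nat (m choose 2) * \<chi>\<^sup>2 else 0)"

text \<open>Write f = X(1 + z) with z of order at least N; then T(X^m) = X^m((1 + z)^m - 1). The
  linear term in z supplies both coefficients, z^2 starts in degree 2N and reaches N + q only if N =
  q, and z^3 lies beyond.\<close>

lemma two_term_compose_diff_X_power:
  fixes f :: "'a::field fps"
  assumes "two_term q (N + 1) \<chi> \<xi> (f - fps_X)" "0 < q" "q \<le> N"
  shows "two_term q (m + N) (of_nat m * \<chi>) (second_coeff q N \<chi> \<xi> m)
           (compose_diff f (fps_X ^ m))"
proof -
  define c where "c = (fps_const :: 'a \<Rightarrow> 'a fps)"
  define C where "C = (of_nat (m choose 2) :: 'a fps)"
  define M where "M = (of_nat m :: 'a fps)"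
  define e where "e = (if N = q then 1 else 0 :: 'a fps)"
  let ?X = "fps_X :: 'a fps"
  obtain s where s: "f - ?X - (c \<chi> * ?X ^ (N+1) + c \<xi> * ?X ^ (N+1+q)) = ?X ^ (N+1+q+1) * s"
    using assms(1) unfolding two_term_def c_def by (elim dvdE)
  define y where "y = c \<chi> + c \<xi> * ?X ^ q + ?X ^ (q+1) * s"
  define z where "z = ?X ^ N * y"
  have f: "f = ?X * (1 + z)"
    using s unfolding z_def y_def by (simp add: algebra_simps power_add)
  have f0: "fps_nth f 0 = 0" by (simp add: f)
  obtain r where r: "(1 + z) ^ m - 1 - M * z - C * z ^ 2 = z ^ 3 * r"
    using power_one_plus_expansion[of z m] unfolding M_def C_def by (elim dvdE)
  have "(?X ^ m oo f) - ?X ^ m = ?X ^ m * ((1 + z) ^ m - 1)"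
    unfolding fps_X_power_compose[OF f0] by (simp only: f power_mult_distrib right_diff_distrib mult_1_right)
  also have "(1 + z) ^ m - 1 = M * z + C * z ^ 2 + z ^ 3 * r"
    unfolding r[symmetric] by simp
  finally have T: "compose_diff f (?X ^ m) = ?X ^ m * (M * z + C * z ^ 2 + z ^ 3 * r)"
    by (simp add: compose_diff_def)
  have 1: "?X ^ (N + q + 1) dvd M * z - (M * c \<chi> * ?X ^ N + M * c \<xi> * ?X ^ (N + q))"
    by (rule dvdI[of _ _ "M * s"]) (simp add: z_def y_def algebra_simps power_add)
  have 2: "?X ^ (N + q + 1) dvd C * z ^ 2 - e * C * c \<chi> ^ 2 * ?X ^ (N + q)"
  proof (cases "N = q")
    case True
    have "z ^ 2 - c \<chi> ^ 2 * ?X ^ (N + q) = ?X ^ (N + q) * ((y - c \<chi>) * (y + c \<chi>))"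
      using True by (simp add: z_def power_mult_distrib algebra_simps power2_eq_square power_add)
    moreover have "?X ^ 1 dvd y - c \<chi>"
      using assms(2) by (simp only: fps_X_power_dvd_iff) (simp add: y_def)
    then have "?X ^ (N + q) * ?X ^ 1 dvd ?X ^ (N + q) * ((y - c \<chi>) * (y + c \<chi>))"
      by (intro mult_dvd_mono dvd_mult2) auto
    ultimately have "?X ^ (N + q + 1) dvd z ^ 2 - c \<chi> ^ 2 * ?X ^ (N + q)"
      by (simp only: power_add)
    then have "?X ^ (N + q + 1) dvd C * (z ^ 2 - c \<chi> ^ 2 * ?X ^ (N + q))" by (rule dvd_mult)
    then show ?thesis using True by (simp add: e_def algebra_simps)
  next
    case False
    then have "?X ^ (N + q + 1) dvd ?X ^ (2 * N)"
      using assms by (intro le_imp_power_dvd) auto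
    moreover have "z ^ 2 = ?X ^ (2 * N) * y ^ 2"
      by (simp add: z_def power_mult_distrib mult.commute flip: power_mult)
    ultimately show ?thesis using False by (simp add: e_def)
  qed
  have 3: "?X ^ (N + q + 1) dvd z ^ 3 * r"
  proof -
    have "?X ^ (N + q + 1) dvd ?X ^ (3 * N)"
      using assms by (intro le_imp_power_dvd) auto
    moreover have "z ^ 3 = ?X ^ (3 * N) * y ^ 3"
      by (simp add: z_def power_mult_distrib mult.commute flip: power_mult)
    ultimately show ?thesis by simp
  qed
  have "?X ^ (N + q + 1) dvd (M * z + C * z ^ 2 + z ^ 3 * r) -
      (M * c \<chi> * ?X ^ N + (M * c \<xi> + e * C * c \<chi> ^ 2) * ?X ^ (N + q))"
    using dvd_add[OF dvd_add[OF 1 2] 3] by (simp add: algebra_simps)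
  then have "?X ^ m * ?X ^ (N + q + 1) dvd ?X ^ m * ((M * z + C * z ^ 2 + z ^ 3 * r) -
      (M * c \<chi> * ?X ^ N + (M * c \<xi> + e * C * c \<chi> ^ 2) * ?X ^ (N + q)))"
    by (rule mult_dvd_mono[OF dvd_refl])
  also have "?X ^ m * ?X ^ (N + q + 1) = ?X ^ (m + N + q + 1)"
    by (simp add: power_add)
  also have "?X ^ m * ((M * z + C * z ^ 2 + z ^ 3 * r) -
      (M * c \<chi> * ?X ^ N + (M * c \<xi> + e * C * c \<chi> ^ 2) * ?X ^ (N + q)))
    = compose_diff f (?X ^ m) - (M * c \<chi> * ?X ^ (m + N) +
        (M * c \<xi> + e * C * c \<chi> ^ 2) * ?X ^ (m + N + q))"
    unfolding T by (simp add: algebra_simps power_add)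
  also have "M * c \<chi> = c (of_nat m * \<chi>)"
    by (simp add: M_def c_def fps_of_nat[symmetric])
  also have "M * c \<xi> + e * C * c \<chi> ^ 2 = c (second_coeff q N \<chi> \<xi> m)"
    by (simp add: M_def C_def c_def e_def second_coeff_def fps_of_nat[symmetric] power2_eq_square
        flip: fps_const_add)
  finally show ?thesis unfolding two_term_def c_def .
qed

text \<open>By linearity each monomial is treated separately. The image of the second one starts in
  degree m + q + N, so only its leading coefficient counts.\<close>

lemma two_term_compose_diff:
  fixes f :: "'a::field fps"
  assumes f: "two_term q (N + 1) \<chi> \<xi> (f - fps_X)" and q: "0 < q" "q \<le> N"
    and \<phi>: "two_term q m u v \<phi>"
  shows "two_term q (m + N) (of_nat m * \<chi> * u)
           (second_coeff q N \<chi> \<xi> m * u + of_nat (m + q) * \<chi> * v) (compose_diff f \<phi>)"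
proof -
  let ?X = "fps_X :: 'a fps"
  obtain s where s: "\<phi> - (fps_const u * ?X ^ m + fps_const v * ?X ^ (m + q)) = ?X ^ (m + q + 1) * s"
    using \<phi> unfolding two_term_def by (elim dvdE)
  then have "\<phi> = fps_const u * ?X ^ m + fps_const v * ?X ^ (m + q) + ?X ^ (m + q + 1) * s"
    by (simp add: algebra_simps)
  then have T: "compose_diff f \<phi> = fps_const u * compose_diff f (?X ^ m)
      + fps_const v * compose_diff f (?X ^ (m + q)) + compose_diff f (?X ^ (m + q + 1) * s)"
    by (simp only: compose_diff_add compose_diff_const_mult)
  have f0: "fps_nth f 0 = 0"
    using f q unfolding two_term_iff[OF q(1)] by (auto dest: spec[of _ 0])
  have 1: "fps_nth (compose_diff f (?X ^ (m + q + 1) * s)) i = 0" if "i \<le> m + N + q" for i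
  proof -
    let ?k = "m + q + 1"
    \<comment> \<open>A twisted Leibniz rule: in both summands the difference operator contributes a
      further factor \<open>fps_X ^ N\<close>, so the remainder stays beyond the window.\<close>
    have "compose_diff f (?X ^ ?k * s) = compose_diff f (?X ^ ?k) * (s oo f) + ?X ^ ?k * compose_diff f s"
      using f0 by (simp add: compose_diff_def fps_compose_mult_distrib algebra_simps)
    moreover have "?X ^ (?k + N) dvd compose_diff f (?X ^ ?k)"
      using two_term_compose_diff_X_power[OF f q, of ?k]
      unfolding two_term_iff[OF q(1)] fps_X_power_dvd_iff by auto
    moreover have "?X ^ N dvd f - ?X"
      using f unfolding two_term_iff[OF q(1)] fps_X_power_dvd_iff by auto
    then have "?X ^ N dvd compose_diff f s"
      using fps_X_power_dvd_compose_diff[of N f ?X s] by (simp add: compose_diff_def)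
    then have "?X ^ (?k + N) dvd ?X ^ ?k * compose_diff f s"
      by (simp add: power_add mult_dvd_mono)
    ultimately have "?X ^ (?k + N) dvd compose_diff f (?X ^ ?k * s)" by simp
    then show ?thesis using that by (simp only: fps_X_power_dvd_iff)
  qed
  show ?thesis
    unfolding two_term_iff[OF q(1)]
  proof (intro allI impI)
    fix i assume i: "i \<le> m + N + q"
    have "fps_nth (compose_diff f (?X ^ m)) i =
      (if i = m + N then of_nat m * \<chi> else if i = m + N + q then second_coeff q N \<chi> \<xi> m else 0)"
      using two_term_compose_diff_X_power[OF f q, of m] i unfolding two_term_iff[OF q(1)] by blast
    moreover have "fps_nth (compose_diff f (?X ^ (m + q))) i =
      (if i = m + N + q then of_nat (m + q) * \<chi> else 0)"
      using two_term_compose_diff_X_power[OF f q, of "m + q"] i q(1) unfolding two_term_iff[OF q(1)]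
      by (auto simp: add.commute add.left_commute)
    ultimately show "fps_nth (compose_diff f \<phi>) i =
      (if i = m + N then of_nat m * \<chi> * u
       else if i = m + N + q then second_coeff q N \<chi> \<xi> m * u + of_nat (m + q) * \<chi> * v else 0)"
      using q(1) 1[OF i] by (simp add: T del: of_nat_add)
  qed
qed

section \<open>The p-fold difference of the variable\<close>

text \<open>\<open>q\<close> is invertible modulo \<open>p\<close>, so 1 + jq meets the zero class
  once per period. The endpoint j = p is included because the subleading factor of the last of
  \<open>p\<close> steps has that index.\<close>

lemma resonance_index:
  assumes p: "prime p" "p = CHAR('a::field)" and "of_nat q \<noteq> (0::'a)"
  obtains j0 where "0 < j0" "j0 < p" "of_nat (1 + j0 * q) = (0::'a)"
    "\<And>j. j \<le> p \<Longrightarrow> of_nat (1 + j * q) = (0::'a) \<Longrightarrow> j = j0"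
proof -
  have "\<not> p dvd q" using assms by (simp add: of_nat_eq_0_iff_char_dvd)
  then have "coprime q p" using p(1) by (metis coprime_commute prime_imp_coprime)
  then obtain x where x: "[q * x = 1] (mod p)" using cong_solve_coprime_nat by auto
  \<comment> \<open>\<open>p - 1\<close> stands for -1 and \<open>x\<close> for 1/q, so
    \<open>j0\<close> represents -1/q modulo \<open>p\<close>.\<close>
  define j0 where "j0 = ((p - 1) * x) mod p"
  have "p > 1" using p(1) by (rule prime_gt_1_nat)
  have "[1 + j0 * q = 1 + (p - 1) * (q * x)] (mod p)"
    unfolding j0_def cong_def by (metis mod_add_right_eq mod_mult_left_eq mult.assoc mult.commute)
  also have "[1 + (p - 1) * (q * x) = 1 + (p - 1) * 1] (mod p)"
    by (intro cong_add cong_mult cong_refl x)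
  also have "[1 + (p - 1) * 1 = 0] (mod p)" using \<open>p > 1\<close> by (simp add: cong_def)
  finally have "p dvd 1 + j0 * q" by (simp add: cong_0_iff)
  then have j0: "of_nat (1 + j0 * q) = (0::'a)" by (simp only: of_nat_eq_0_iff_char_dvd p)
  then have "j0 \<noteq> 0" by (metis add.right_neutral mult_0 of_nat_1 zero_neq_one)
  moreover have "j0 < p" using \<open>p > 1\<close> by (simp add: j0_def)
  moreover have "j = j0" if "j \<le> p" "of_nat (1 + j * q) = (0::'a)" for j
  proof -
    have "of_nat (1 + j * q) = (of_nat (1 + j0 * q) :: 'a)"
      by (simp only: that(2) j0)
    then have "of_nat j = (of_nat j0 :: 'a)" using assms(3) by simp
    then have "[j = j0] (mod p)" using p(2) by (simp add: of_nat_eq_iff_cong_CHAR)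
    \<comment> \<open>The case j = p would make \<open>j0\<close> congruent to 0.\<close>
    then show ?thesis using \<open>j0 < p\<close> \<open>j0 \<noteq> 0\<close> that(1)
      by (cases "j = p") (auto simp: cong_def)
  qed
  ultimately show ?thesis using that j0 by blast
qed

text \<open>The leading coefficient of $T^j(X)$ is a product of the factors $1 + iq$ with \<open>i < j\<close> and
  dies as soon as \<open>j\<close> passes the unique \<open>j0\<close> with $p \mid 1 + j_0 q$; only the subleading
  coefficient created at the step from \<open>j0 - 1\<close> to \<open>j0\<close> survives.\<close>

lemma two_term_compose_diff_funpow_CHAR:
  fixes f :: "'a::field fps"
  assumes p: "prime p" "p = CHAR('a)" and q: "0 < q" "q \<le> N" "of_nat q \<noteq> (0::'a)"
    and N: "of_nat N = (of_nat q :: 'a)"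
    and f: "two_term q (N + 1) \<chi> \<xi> (f - fps_X)" and \<chi>: "\<chi> \<noteq> 0"
    and c0: "\<And>m. of_nat m = (0::'a) \<Longrightarrow> second_coeff q N \<chi> \<xi> m = 0"
    and c1: "\<And>m. of_nat m = (- of_nat q :: 'a) \<Longrightarrow> second_coeff q N \<chi> \<xi> m = \<kappa>"
  shows "\<exists>v. two_term q (1 + p * N) 0 v ((compose_diff f ^^ p) fps_X) \<and> (v = 0 \<longleftrightarrow> \<kappa> = 0)"
proof -
  let ?T = "\<lambda>j. (compose_diff f ^^ j) fps_X"
  obtain j0 where j0: "0 < j0" "j0 < p" "of_nat (1 + j0 * q) = (0::'a)"
    and unique: "\<And>j. j \<le> p \<Longrightarrow> of_nat (1 + j * q) = (0::'a) \<Longrightarrow> j = j0"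
    using resonance_index[OF p q(3)] by blast
  \<comment> \<open>As N = q in the field, the exponents met after j steps act as 1 + jq and 1 + (j
    + 1)q.\<close>
  have w: "of_nat (1 + j * N) = (of_nat (1 + j * q) :: 'a)"
    "of_nat (1 + j * N + q) = (of_nat (1 + Suc j * q) :: 'a)" for j
    using N by (simp_all add: algebra_simps)
  have step: "two_term q (1 + Suc j * N) (of_nat (1 + j * q) * \<chi> * u)
      (second_coeff q N \<chi> \<xi> (1 + j * N) * u + of_nat (1 + Suc j * q) * \<chi> * v) (?T (Suc j))"
    if "two_term q (1 + j * N) u v (?T j)" for j u v
    using two_term_compose_diff[OF f q(1,2) that] unfolding w by (simp add: algebra_simps)
  have A: "\<exists>u v. two_term q (1 + j * N) u v (?T j) \<and> u \<noteq> 0" if "j < j0" for j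
    using that
  proof (induction j)
    case 0
    have "two_term q (1 + 0 * N) 1 0 (?T 0)" by (simp add: two_term_def)
    then show ?case by (intro exI) auto
  next
    case (Suc j)
    then obtain u v where "two_term q (1 + j * N) u v (?T j)" "u \<noteq> 0" by auto
    with step[of j u v] unique[of j] Suc.prems j0 \<chi> show ?case
      by (intro exI conjI) (assumption, auto simp del: of_nat_add of_nat_Suc of_nat_mult)
  qed
  obtain i where i: "j0 = Suc i" using j0(1) by (cases j0) auto
  obtain u v where uv: "two_term q (1 + i * N) u v (?T i)" "u \<noteq> 0" using A[of i] i by auto
  define u' where "u' = of_nat (1 + i * q) * \<chi> * u"
  have "u' \<noteq> 0" using unique[of i] i j0 uv \<chi> by (auto simp: u'_def simp del: of_nat_add of_nat_mult)
  \<comment> \<open>At this step the exponent is -q in the field, so the hypothesis on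
    \<open>\<kappa>\<close> applies, while the old subleading coefficient \<open>v\<close> gets the
    factor 1 + j0 q = 0 and drops out.\<close>
  have "of_nat (1 + i * N) = (- of_nat q :: 'a)"
    unfolding w using j0(3) i by (simp add: eq_neg_iff_add_eq_0 add.commute add.left_commute)
  from step[OF uv(1)] c1[OF this] j0(3)
  have j0': "two_term q (1 + j0 * N) u' (\<kappa> * u) (?T j0)" unfolding i u'_def by simp
  \<comment> \<open>The exponent is now zero in the field: the leading monomial contributes to
    neither coefficient, and the subleading one is merely rescaled.\<close>
  have "second_coeff q N \<chi> \<xi> (1 + j0 * N) = 0" by (rule c0) (simp only: w j0)
  with step[OF j0'] j0(3)
  have j1: "two_term q (1 + Suc j0 * N) 0 (of_nat (1 + Suc j0 * q) * \<chi> * (\<kappa> * u)) (?T (Suc j0))"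
    by simp
  \<comment> \<open>The remaining factors 1 + jq with j0 < j <= p are nonzero because
    \<open>j0\<close> is the only zero in the range.\<close>
  have B: "\<exists>v. two_term q (1 + (Suc j0 + d) * N) 0 v (?T (Suc j0 + d)) \<and> (v = 0 \<longleftrightarrow> \<kappa> = 0)"
    if "Suc j0 + d \<le> p" for d
    using that
  proof (induction d)
    case 0
    have "of_nat (1 + Suc j0 * q) * \<chi> * (\<kappa> * u) = 0 \<longleftrightarrow> \<kappa> = 0"
      using 0 unique[of "Suc j0"] uv \<chi> by (simp only: mult_eq_0_iff) auto
    with j1 show ?case unfolding add_0_right by blast
  next
    case (Suc d)
    then obtain v where v: "two_term q (1 + (Suc j0 + d) * N) 0 v (?T (Suc j0 + d))"
      "v = 0 \<longleftrightarrow> \<kappa> = 0" by auto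
    from step[OF v(1)] have "two_term q (1 + (Suc j0 + Suc d) * N) 0
       (of_nat (1 + (Suc j0 + Suc d) * q) * \<chi> * v) (?T (Suc j0 + Suc d))" by simp
    then show ?case using unique[of "Suc j0 + Suc d"] v(2) \<chi> Suc.prems
      by (intro exI conjI) (assumption, auto simp del: of_nat_add of_nat_Suc of_nat_mult)
  qed
  from B[of "p - Suc j0"] j0(2) show ?thesis by simp
qed

section \<open>Ramification indices and conjugation\<close>

lemma ram_index_eq_enat_iff:
  fixes h :: "'a::field fps"
  assumes "fps_nth h 0 = 0"
  shows "ram_index n h = enat N \<longleftrightarrow>
    fps_X ^ (N + 1) dvd fps_iter h (CHAR('a) ^ n) - fps_X \<and>
    \<not> fps_X ^ (N + 2) dvd fps_iter h (CHAR('a) ^ n) - fps_X"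
proof -
  define D where "D = fps_iter h (CHAR('a) ^ n) - fps_X"
  define d where "d = D / fps_X"
  have D0: "fps_nth D 0 = 0" using assms by (simp add: D_def)
  have d: "fps_nth d i = fps_nth D (Suc i)" for i by (simp add: d_def)
  have "(\<forall>i<Suc k. fps_nth D i = 0) \<longleftrightarrow> (\<forall>i<k. fps_nth d i = 0)" for k
    using D0 by (simp add: d All_less_Suc2)
  then have dvd: "fps_X ^ Suc k dvd D \<longleftrightarrow> fps_X ^ k dvd d" for k
    by (simp only: fps_X_power_dvd_iff)
  have "ram_index n h = enat N \<longleftrightarrow> d \<noteq> 0 \<and> subdegree d = N"
    by (auto simp: ram_index_def Let_def d_def D_def)
  also have "\<dots> \<longleftrightarrow> fps_X ^ N dvd d \<and> \<not> fps_X ^ Suc N dvd d"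
    by (cases "d = 0") (auto simp: fps_dvd_iff)
  finally show ?thesis using dvd[of N] dvd[of "Suc N"] by (simp add: D_def del: power_Suc)
qed

lemma fps_inv_nth_0 [simp]: "fps_nth (fps_inv h) 0 = 0"
  by (simp add: fps_inv_def)

lemma fps_X_power_dvd_conj:
  fixes F h k :: "'a::field fps"
  assumes "fps_nth k 0 = 0" "h oo k = fps_X" "fps_X ^ m dvd F - fps_X"
  shows "fps_X ^ m dvd ((h oo F) oo k) - fps_X"
proof -
  have "fps_X ^ m dvd (h oo F) - (h oo fps_X)"
    by (rule fps_X_power_dvd_compose_diff) fact
  from fps_X_power_dvd_compose[OF this assms(1)] show ?thesis
    by (simp add: fps_compose_sub_distrib assms(2))
qed

text \<open>Iterates of conjugates are conjugate by the same series, and conjugation preserves the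
  order of contact with the identity. The two directions use \<open>h\<close> and its
  inverse.\<close>

lemma fps_X_power_dvd_fps_iter_conjugated:
  fixes g :: "'a::field fps"
  assumes "fps_conjugated g g'" "fps_nth g 0 = 0"
  shows "fps_X ^ m dvd fps_iter g' n - fps_X \<longleftrightarrow> fps_X ^ m dvd fps_iter g n - fps_X"
proof -
  from assms(1) obtain h where h: "fps_nth h 0 = 0" "fps_nth h 1 \<noteq> 0"
    and g': "g' = (h oo g) oo fps_inv h"
    by (auto simp: fps_conjugated_def fps_invertible_series_def)
  define k where "k = fps_inv h"
  have k: "fps_nth k 0 = 0" "k oo h = fps_X" "h oo k = fps_X"
    using h by (simp_all add: k_def fps_inv fps_inv_right)
  have iter: "fps_iter g' n = (h oo fps_iter g n) oo k"
    unfolding g' k_def[symmetric] using assms(2) h k by (intro fps_iter_conj) auto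
  have "(k oo ((h oo fps_iter g n) oo k)) oo h = ((k oo h) oo fps_iter g n) oo (k oo h)"
    using h k(1) assms(2) by (simp add: fps_compose_assoc)
  then have "fps_iter g n = (k oo fps_iter g' n) oo h"
    using k assms(2) by (simp add: iter)
  then show ?thesis
    using fps_X_power_dvd_conj[OF k(1,3), of m "fps_iter g n"]
      fps_X_power_dvd_conj[OF h(1) k(2), of m "fps_iter g' n"] iter by auto
qed

lemma ram_index_conjugated_iff:
  fixes g :: "'a::field fps"
  assumes "fps_conjugated g g'" "fps_nth g 0 = 0"
  shows "ram_index n (fps_iter g' q) = enat N \<longleftrightarrow> ram_index n (fps_iter g q) = enat N"
proof -
  have "fps_nth g' 0 = 0" using assms by (auto simp: fps_conjugated_def fps_invertible_series_def)
  then show ?thesis using assms(2)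
    by (simp add: ram_index_eq_enat_iff fps_X_power_dvd_fps_iter_conjugated[OF assms]
        del: power_Suc flip: fps_iter_mult)
qed

section \<open>Existence of the normal form\<close>

lemma primitive_root_power_eq_1_iff:
  fixes \<gamma> :: "'a::field"
  assumes "q > 0" "\<gamma> ^ q = 1" "\<forall>m. 0 < m \<and> m < q \<longrightarrow> \<gamma> ^ m \<noteq> 1"
  shows "\<gamma> ^ i = 1 \<longleftrightarrow> q dvd i"
proof -
  have "\<gamma> ^ i = \<gamma> ^ (q * (i div q) + i mod q)" by simp
  also have "\<dots> = \<gamma> ^ (i mod q)" unfolding power_add power_mult by (simp add: assms(2))
  finally have i: "\<gamma> ^ i = \<gamma> ^ (i mod q)" .
  show ?thesis
  proof (cases "i mod q = 0")
    case False
    then have "\<gamma> ^ (i mod q) \<noteq> 1" using assms by simp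
    with False show ?thesis by (simp add: i dvd_eq_mod_eq_0)
  qed (simp add: i dvd_eq_mod_eq_0)
qed

lemma normal_form_iff:
  "normal_form q \<gamma> g \<longleftrightarrow> fps_nth g 0 = 0 \<and> fps_nth g 1 = \<gamma> \<and>
     (\<forall>i. fps_nth g (Suc i) \<noteq> 0 \<longrightarrow> q dvd i)"
proof -
  have "(\<exists>j. Suc i = j * q + 1) \<longleftrightarrow> q dvd i" for i by (auto simp: dvd_def mult.commute)
  then have "(\<forall>m. (\<not> (\<exists>j. m = j * q + 1)) \<longrightarrow> fps_nth g m = 0) \<longleftrightarrow>
      fps_nth g 0 = 0 \<and> (\<forall>i. fps_nth g (Suc i) \<noteq> 0 \<longrightarrow> q dvd i)"
    by (metis One_nat_def add.commute nat.distinct(1) not0_implies_Suc plus_1_eq_Suc)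
  then show ?thesis unfolding normal_form_def by blast
qed

text \<open>Adding cX^m to H changes the degree-m defect by c(\<open>\<gamma>\<close>^m -
  \<open>\<gamma>\<close>), adding dX^m to G changes it by -d. If q does not divide m - 1, then
  \<open>\<gamma>\<close>^m differs from \<open>\<gamma>\<close> and c removes the defect; otherwise
  d absorbs it, and the normal form admits this monomial.\<close>

lemma normal_form_extend:
  fixes g H G :: "'a::field fps"
  assumes \<gamma>: "q > 0" "\<gamma> ^ q = 1" "\<forall>m. 0 < m \<and> m < q \<longrightarrow> \<gamma> ^ m \<noteq> 1"
    and g: "fps_nth g 0 = 0" "fps_nth g 1 = \<gamma>" and m: "m \<ge> 2"
    and H: "fps_nth H 0 = 0" "fps_nth H 1 = 1" and G: "normal_form q \<gamma> G"
    and dvd: "fps_X ^ m dvd (H oo g) - (G oo H)"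
  shows "\<exists>H' G'. fps_nth H' 0 = 0 \<and> fps_nth H' 1 = 1 \<and> normal_form q \<gamma> G' \<and>
    fps_X ^ Suc m dvd (H' oo g) - (G' oo H') \<and> fps_X ^ m dvd H' - H \<and> fps_X ^ m dvd G' - G"
proof -
  let ?X = "fps_X :: 'a fps"
  define e where "e = fps_nth ((H oo g) - (G oo H)) m"
  define res where "res \<longleftrightarrow> q dvd m - 1"
  define c where "c = (if res then 0 else e / (\<gamma> - \<gamma> ^ m))"
  define d where "d = (if res then e else 0)"
  define H' where "H' = H + fps_const c * ?X ^ m"
  define G' where "G' = G + fps_const d * ?X ^ m"
  have \<gamma>m: "\<gamma> ^ m = \<gamma> * \<gamma> ^ (m - 1)" using m by (cases m) auto
  have "\<gamma> \<noteq> 0" using \<gamma> by (auto simp: power_0_left)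
  then have "e + c * \<gamma> ^ m - \<gamma> * c - d = 0"
    using primitive_root_power_eq_1_iff[OF \<gamma>, of "m - 1"]
    by (auto simp: c_def d_def res_def \<gamma>m field_simps)
  then have e0: "e + c * \<gamma> ^ m = \<gamma> * c + d" by (simp add: algebra_simps)
  have H': "fps_nth H' 0 = 0" "fps_nth H' 1 = 1"
    using H m by (simp_all add: H'_def fps_X_power_mult_right_nth)
  have G': "normal_form q \<gamma> G'"
    using G m unfolding normal_form_iff by (auto simp: G'_def fps_X_power_mult_right_nth d_def res_def)
  have G0: "fps_nth G 0 = 0" "fps_nth G 1 = \<gamma>" using G by (simp_all add: normal_form_def)
  \<comment> \<open>Splitting off the linear part of \<open>G\<close> shows that changing
    \<open>H\<close> in degree m affects the nonlinear part of the composition only beyond degree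
    m.\<close>
  have "?X ^ 2 dvd G - fps_const \<gamma> * ?X"
    using G0 by (auto simp: fps_X_power_dvd_iff less_2_cases_iff)
  then obtain K where "G - fps_const \<gamma> * ?X = ?X ^ 2 * K" by (elim dvdE)
  then have K: "G = fps_const \<gamma> * ?X + ?X ^ 2 * K" by (simp add: algebra_simps)
  have GA: "G oo A = fps_const \<gamma> * A + A ^ 2 * (K oo A)" if "fps_nth A 0 = 0" for A
    using that unfolding K
    by (simp add: fps_compose_add_distrib fps_compose_mult_distrib fps_X_power_compose)
  have X: "?X ^ 1 dvd H'" "?X ^ 1 dvd H" using H H' by (simp_all only: fps_X_power_dvd_iff) simp_all
  have HH: "H' - H = fps_const c * ?X ^ m" by (simp add: H'_def)
  have "(G oo H') - (G oo H) - fps_const (\<gamma> * c) * ?X ^ m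
      = H' ^ 2 * ((K oo H') - (K oo H)) + (H' - H) * (H' + H) * (K oo H)"
    unfolding GA[OF H(1)] GA[OF H'(1)]
    by (simp add: H'_def algebra_simps power2_eq_square flip: fps_const_mult)
  moreover have "?X ^ m dvd (K oo H') - (K oo H)"
    by (rule fps_X_power_dvd_compose_diff) (simp add: HH)
  then have "?X ^ 1 * ?X ^ m dvd H' ^ 2 * ((K oo H') - (K oo H))"
    using X by (intro mult_dvd_mono) (simp_all add: power2_eq_square)
  moreover have "?X ^ m * ?X ^ 1 dvd (H' - H) * (H' + H)"
    using X by (intro mult_dvd_mono dvd_add) (simp_all add: HH)
  then have "?X ^ m * ?X ^ 1 dvd (H' - H) * (H' + H) * (K oo H)" by (rule dvd_mult2)
  ultimately have "?X ^ Suc m dvd (G oo H') - (G oo H) - fps_const (\<gamma> * c) * ?X ^ m"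
    by (simp add: mult.commute)
  then have GH: "fps_nth (G oo H') i = fps_nth (G oo H) i + (if i = m then \<gamma> * c else 0)"
    if "i < Suc m" for i
  proof -
    from \<open>?X ^ Suc m dvd _\<close> that
    have "fps_nth ((G oo H') - (G oo H) - fps_const (\<gamma> * c) * ?X ^ m) i = 0"
      unfolding fps_X_power_dvd_iff by blast
    then show ?thesis by (cases "i = m") (simp_all add: fps_X_power_mult_right_nth algebra_simps)
  qed
  have lead: "fps_nth (fps_const a * A ^ m) i = (if i = m then a * fps_nth A 1 ^ m else 0)"
    if "i < Suc m" "fps_nth A 0 = 0" for i a A
  proof (cases "i = m")
    case True
    have "fps_nth (A ^ m) m = fps_nth A 1 ^ m" by (rule startsby_zero_power_nth_same[OF that(2)])
    with True show ?thesis by simp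
  next
    case False
    then have "i < m" using that(1) by simp
    then have "fps_nth (A ^ m) i = 0" using startsby_zero_power_prefix[OF that(2)] by blast
    with False show ?thesis by simp
  qed
  have 1: "H' oo g = (H oo g) + fps_const c * g ^ m"
    using g(1) by (simp add: H'_def fps_compose_add_distrib fps_compose_mult_distrib fps_X_power_compose)
  have 2: "G' oo H' = (G oo H') + fps_const d * H' ^ m"
    using H'(1) by (simp add: G'_def fps_compose_add_distrib fps_compose_mult_distrib fps_X_power_compose)
  have "fps_nth ((H' oo g) - (G' oo H')) i = 0" if i: "i < Suc m" for i
  proof (cases "i = m")
    case True
    note i' = i[unfolded True]
    have "fps_nth (fps_const c * g ^ m) m = c * \<gamma> ^ m" "fps_nth (fps_const d * H' ^ m) m = d"
      "fps_nth (G oo H') m = fps_nth (G oo H) m + \<gamma> * c"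
      unfolding lead[OF i' g(1)] lead[OF i' H'(1)] GH[OF i'] g H' by simp_all
    then show ?thesis unfolding 1 2 True using e0 unfolding e_def
      by (simp del: fps_mult_left_const_nth add: algebra_simps)
  next
    case False
    with i dvd have "fps_nth ((H oo g) - (G oo H)) i = 0" by (simp add: fps_X_power_dvd_iff)
    with False show ?thesis unfolding 1 2
      by (simp add: lead[OF i g(1)] lead[OF i H'(1)] GH[OF i] del: fps_mult_left_const_nth)
  qed
  then have "?X ^ Suc m dvd (H' oo g) - (G' oo H')" unfolding fps_X_power_dvd_iff by blast
  moreover have "?X ^ m dvd H' - H" "?X ^ m dvd G' - G" by (simp_all add: H'_def G'_def)
  ultimately show ?thesis using H' G' by blast
qed

text \<open>From index n on, the coefficients below degree n + 2 no longer change, so the diagonal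
  sequence of coefficients defines the limit.\<close>

lemma fps_sequence_limit:
  fixes A :: "nat \<Rightarrow> 'a::field fps"
  assumes "\<And>n. fps_X ^ (n + 2) dvd A (Suc n) - A n"
  obtains L where "\<And>n. fps_X ^ (n + 2) dvd L - A n"
proof
  have step: "fps_nth (A (n + k)) i = fps_nth (A n) i" if "i < n + 2" for i n k
  proof (induction k)
    case (Suc k)
    have "fps_nth (A (Suc (n + k)) - A (n + k)) i = 0"
      using assms[of "n + k"] that by (simp only: fps_X_power_dvd_iff)
    with Suc show ?case by simp
  qed simp
  show "fps_X ^ (n + 2) dvd Abs_fps (\<lambda>i. fps_nth (A i) i) - A n" for n
    unfolding fps_X_power_dvd_iff
  proof (intro allI impI)
    fix i assume "i < n + 2"
    then have "fps_nth (A i) i = fps_nth (A n) i"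
      using step[of i n "i - n"] step[of i i "n - i"] by (cases "i \<le> n") auto
    then show "fps_nth (Abs_fps (\<lambda>i. fps_nth (A i) i) - A n) i = 0" by simp
  qed
qed

text \<open>Dependent choice iterates the degree-by-degree correction; the limits h and g' satisfy h
  o g = g' o h exactly, and h has linear coefficient 1, hence is invertible.\<close>

lemma normal_form_exists:
  fixes g :: "'a::field fps"
  assumes \<gamma>: "q > 0" "\<gamma> ^ q = 1" "\<forall>m. 0 < m \<and> m < q \<longrightarrow> \<gamma> ^ m \<noteq> 1"
    and g: "fps_nth g 0 = 0" "fps_nth g 1 = \<gamma>"
  shows "\<exists>g'. fps_conjugated g g' \<and> normal_form q \<gamma> g'"
proof -
  let ?X = "fps_X :: 'a fps"
  define P where "P n x \<longleftrightarrow> (case x of (H, G) \<Rightarrow> fps_nth H 0 = 0 \<and> fps_nth H 1 = 1 \<and>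
    normal_form q \<gamma> G \<and> ?X ^ (n + 2) dvd (H oo g) - (G oo H))" for n x
  define Q where "Q n x y \<longleftrightarrow> ?X ^ (n + 2) dvd fst y - fst x \<and> ?X ^ (n + 2) dvd snd y - snd x"
    for n and x y :: "'a fps \<times> 'a fps"
  have "\<exists>A. \<forall>n. P n (A n) \<and> Q n (A n) (A (Suc n))"
  proof (rule dependent_nat_choice)
    \<comment> \<open>The identity and the linear part of \<open>g\<close> agree with the required
      relation in degrees 0 and 1.\<close>
    have "P 0 (?X, fps_const \<gamma> * ?X)"
      using g unfolding P_def
      by (simp only: fps_X_power_dvd_iff) (auto simp: normal_form_iff less_Suc_eq numeral_2_eq_2)
    then show "\<exists>x. P 0 x" by blast
  next
    fix x n assume "P n x"
    then show "\<exists>y. P (Suc n) y \<and> Q n x y"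
      using normal_form_extend[OF \<gamma> g, of "n + 2" "fst x" "snd x"]
      by (auto simp: P_def Q_def split: prod.splits)
  qed
  then obtain A where A: "\<And>n. P n (A n)" "\<And>n. Q n (A n) (A (Suc n))" by blast
  obtain h where h: "\<And>n. ?X ^ (n + 2) dvd h - fst (A n)"
    using fps_sequence_limit[of "\<lambda>n. fst (A n)"] A(2) unfolding Q_def by blast
  obtain g' where g': "\<And>n. ?X ^ (n + 2) dvd g' - snd (A n)"
    using fps_sequence_limit[of "\<lambda>n. snd (A n)"] A(2) unfolding Q_def by blast
  have A': "fps_nth (fst (A n)) 0 = 0" "fps_nth (fst (A n)) 1 = 1" "normal_form q \<gamma> (snd (A n))"
    "?X ^ (n + 2) dvd (fst (A n) oo g) - (snd (A n) oo fst (A n))" for n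
    using A(1)[of n] by (auto simp: P_def split: prod.splits)
  have eqA: "fps_nth h i = fps_nth (fst (A n)) i" "fps_nth g' i = fps_nth (snd (A n)) i"
    if "i < n + 2" for i n
    using h[of n] g'[of n] that unfolding fps_X_power_dvd_iff by auto
  have h0: "fps_nth h 0 = 0" "fps_nth h 1 = 1" using eqA(1)[of _ 0] A'[of 0] by auto
  have nf: "normal_form q \<gamma> g'"
    unfolding normal_form_iff
  proof (intro conjI allI impI)
    show "fps_nth g' 0 = 0" "fps_nth g' 1 = \<gamma>"
      using eqA(2)[of _ 0] A'(3)[of 0] by (auto simp: normal_form_iff)
    show "q dvd i" if "fps_nth g' (Suc i) \<noteq> 0" for i
      using that eqA(2)[of "Suc i" i] A'(3)[of i] by (auto simp: normal_form_iff)
  qed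
  have "?X ^ (n + 2) dvd (h oo g) - (g' oo h)" for n
  proof -
    let ?H = "fst (A n)" and ?G = "snd (A n)"
    have "?X ^ (n + 2) dvd (h - ?H) oo g" "?X ^ (n + 2) dvd (g' - ?G) oo h"
      using h[of n] g'[of n] g(1) h0(1) by (simp_all only: fps_X_power_dvd_compose)
    moreover have "?X ^ (n + 2) dvd (?G oo h) - (?G oo ?H)"
      using h[of n] by (rule fps_X_power_dvd_compose_diff)
    \<comment> \<open>The error telescopes through the n-th approximations, and every summand is
      divisible by \<open>fps_X ^ (n + 2)\<close>.\<close>
    moreover have "(h oo g) - (g' oo h) = ((h - ?H) oo g) + ((?H oo g) - (?G oo ?H))
        - ((g' - ?G) oo h) - ((?G oo h) - (?G oo ?H))"
      by (simp add: fps_compose_sub_distrib)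
    ultimately show ?thesis using A'(4)[of n] by (metis dvd_add dvd_diff)
  qed
  then have "fps_nth ((h oo g) - (g' oo h)) n = 0" for n
    unfolding fps_X_power_dvd_iff by (meson less_add_same_cancel1 zero_less_numeral)
  then have "h oo g = g' oo h" by (simp add: fps_eq_iff)
  then have "(h oo g) oo fps_inv h = g' oo (h oo fps_inv h)"
    using h0 by (simp add: fps_compose_assoc)
  also have "\<dots> = g'" using h0 by (simp add: fps_inv_right)
  finally have "fps_conjugated g g'"
    using h0 unfolding fps_conjugated_def fps_invertible_series_def by (metis one_neq_zero)
  with nf show ?thesis by blast
qed

section \<open>Iterates of normal forms and commuting series\<close>

lemma two_term_add:
  assumes "0 < q" "two_term q m u v \<phi>" "two_term q m u' v' \<psi>"
  shows "two_term q m (u + u') (v + v') (\<phi> + \<psi>)"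
  using assms(2,3) unfolding two_term_iff[OF assms(1)] by simp

text \<open>Serves to add a series starting in degree m + q to one starting in degree m within the
  same window.\<close>

lemma two_term_shift:
  assumes q: "0 < q" and "two_term q (m + q) u v \<phi>"
  shows "two_term q m 0 u \<phi>"
  unfolding two_term_iff[OF q]
proof (intro allI impI)
  fix i assume i: "i \<le> m + q"
  then have "fps_nth \<phi> i = (if i = m + q then u else if i = m + q + q then v else 0)"
    using assms(2) unfolding two_term_iff[OF q] by (meson le_add1 le_trans)
  with i q show "fps_nth \<phi> i = (if i = m then 0 else if i = m + q then u else 0)" by auto
qed

text \<open>Passing from j to j + 1 adds g - X and T(g^j - X). The latter starts in degree 2q + 1
  with coefficient (q + 1) j a^2, and summing these over j gives the binomial coefficient.\<close>

lemma two_term_fps_iter: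
  fixes g :: "'a::field fps"
  assumes g: "two_term q (q + 1) a b (g - fps_X)" and q: "0 < q"
  shows "two_term q (q + 1) (of_nat j * a)
    (of_nat j * b + of_nat (j choose 2) * of_nat (q + 1) * a\<^sup>2) (fps_iter g j - fps_X)"
proof (induction j)
  case 0
  show ?case by (simp add: two_term_def numeral_2_eq_2)
next
  case (Suc j)
  have g0: "fps_nth g 0 = 0"
    using g unfolding two_term_iff[OF q] by (auto dest: spec[of _ 0])
  have eq: "fps_iter g (Suc j) - fps_X =
      compose_diff g (fps_iter g j - fps_X) + (fps_iter g j - fps_X) + (g - fps_X)"
    using g0 by (simp add: fps_iter_Suc_right compose_diff_def fps_compose_sub_distrib)
  have "of_nat (Suc j choose 2) = (of_nat j + of_nat (j choose 2) :: 'a)"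
    by (simp add: numeral_2_eq_2)
  then have u: "of_nat (Suc j) * a = 0 + of_nat j * a + a"
    and v: "of_nat (Suc j) * b + of_nat (Suc j choose 2) * of_nat (q + 1) * a\<^sup>2 =
      of_nat (q + 1) * a * (of_nat j * a) +
      (of_nat j * b + of_nat (j choose 2) * of_nat (q + 1) * a\<^sup>2) + b"
    by (simp_all add: algebra_simps power2_eq_square)
  have "two_term q (q + 1) 0 (of_nat (q + 1) * a * (of_nat j * a))
      (compose_diff g (fps_iter g j - fps_X))"
    using two_term_compose_diff[OF g q order_refl Suc] by (rule two_term_shift[OF q])
  from two_term_add[OF q two_term_add[OF q this Suc] g] show ?case unfolding eq u v .
qed

lemma normal_form_compose_rotation:
  fixes G :: "'a::field fps"
  assumes G: "normal_form q 1 G" and c: "c ^ q = 1"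
  shows "G oo (fps_const c * fps_X) = fps_const c * G"
proof -
  have "c ^ i * fps_nth G i = c * fps_nth G i" for i
  proof (cases i)
    case (Suc k)
    show ?thesis
    proof (cases "fps_nth G i = 0")
      case False
      then have "q dvd k" using G Suc by (auto simp: normal_form_iff)
      then have "c ^ k = 1" using c by (auto simp: power_mult elim!: dvdE)
      then show ?thesis by (simp add: Suc)
    qed simp
  qed (use G in \<open>simp add: normal_form_def\<close>)
  then show ?thesis by (simp add: fps_eq_iff)
qed

lemma normal_form_compose_const_mult:
  fixes G :: "'a::field fps"
  assumes G: "normal_form q 1 G" and c: "c ^ q = 1" and "fps_nth \<phi> 0 = 0"
  shows "G oo (fps_const c * \<phi>) = fps_const c * (G oo \<phi>)"
proof -
  have "fps_const c * \<phi> = (fps_const c * fps_X) oo \<phi>"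
    using assms(3) by (simp flip: fps_const_mult_apply_left)
  then have "G oo (fps_const c * \<phi>) = (G oo (fps_const c * fps_X)) oo \<phi>"
    using assms(3) by (simp add: fps_compose_assoc)
  then show ?thesis
    using normal_form_compose_rotation[OF G c] by (simp flip: fps_const_mult_apply_left)
qed

text \<open>The linear part of a normal form commutes with the rest, hence drops out of the
  \<open>q\<close>-th iterate.\<close>

lemma fps_iter_normal_form_scale:
  fixes G :: "'a::field fps"
  assumes G: "normal_form q 1 G" and c: "c ^ q = 1"
  shows "fps_iter (fps_const c * G) j = fps_const (c ^ j) * fps_iter G j"
proof (induction j)
  case (Suc j)
  have G0: "fps_nth G 0 = 0" using G by (simp add: normal_form_def)
  have "(c ^ j) ^ q = 1" using c by (metis mult.commute power_mult power_one)
  then have "G oo (fps_const (c ^ j) * fps_iter G j) = fps_const (c ^ j) * (G oo fps_iter G j)"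
    using G0 by (intro normal_form_compose_const_mult[OF G]) auto
  then show ?case
    by (simp add: fps_iter_Suc Suc mult.assoc flip: fps_const_mult_apply_left fps_const_mult)
qed simp

text \<open>A normal form commutes with the rotation by \<open>\<gamma>\<close>, hence so do its
  iterates; commuting with a rotation of exact order q in turn leaves only exponents congruent to 1
  modulo q.\<close>

lemma normal_form_fps_iter:
  fixes G :: "'a::field fps" and \<gamma> :: 'a
  assumes \<gamma>: "q > 0" "\<gamma> ^ q = 1" "\<forall>m. 0 < m \<and> m < q \<longrightarrow> \<gamma> ^ m \<noteq> 1"
    and G: "normal_form q 1 G"
  shows "normal_form q 1 (fps_iter G n)"
proof -
  have G0: "fps_nth G 0 = 0" and G1: "fps_nth G 1 = 1" using G by (simp_all add: normal_form_def)
  have rot: "fps_iter G n oo (fps_const \<gamma> * fps_X) = fps_const \<gamma> * fps_iter G n" for n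
  proof (induction n)
    case (Suc n)
    have "fps_iter G (Suc n) oo (fps_const \<gamma> * fps_X) = G oo (fps_const \<gamma> * fps_iter G n)"
      using G0 by (simp add: fps_iter_Suc Suc flip: fps_compose_assoc)
    then show ?case
      using normal_form_compose_const_mult[OF G \<gamma>(2), of "fps_iter G n"] G0 by (simp add: fps_iter_Suc)
  qed simp
  have "fps_nth (fps_iter G n) 1 = 1"
  proof (induction n)
    case (Suc n)
    then show ?case using G0 G1 by (simp add: fps_iter_Suc fps_compose_nth)
  qed simp
  moreover have "q dvd i" if "fps_nth (fps_iter G n) (Suc i) \<noteq> 0" for i
  proof -
    have "\<gamma> ^ Suc i * fps_nth (fps_iter G n) (Suc i) = \<gamma> * fps_nth (fps_iter G n) (Suc i)"
      using arg_cong[OF rot[of n], of "\<lambda>\<phi>. fps_nth \<phi> (Suc i)"] by simp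
    moreover have "\<gamma> \<noteq> 0" using \<gamma> by (auto simp: power_0_left)
    ultimately have "\<gamma> ^ i = 1" using that by simp
    then show ?thesis using primitive_root_power_eq_1_iff[OF \<gamma>] by simp
  qed
  ultimately show ?thesis using G0 by (simp add: normal_form_iff)
qed

text \<open>As q divides N, no exponent strictly between N + 1 and N + 1 + q is congruent to 1
  modulo q.\<close>

lemma normal_form_two_term:
  assumes F: "normal_form q 1 F" and q: "0 < q" and N: "q dvd N" "0 < N"
    and dvd: "fps_X ^ (N + 1) dvd F - fps_X"
  shows "two_term q (N + 1) (fps_nth F (N + 1)) (fps_nth F (N + 1 + q)) (F - fps_X)"
  unfolding two_term_iff[OF q]
proof (intro allI impI)
  fix i assume i: "i \<le> N + 1 + q"
  consider "i < N + 1" | "i = N + 1" | "i = N + 1 + q" | "N + 1 < i" "i < N + 1 + q" using i by linarith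
  then show "fps_nth (F - fps_X) i =
      (if i = N + 1 then fps_nth F (N + 1) else if i = N + 1 + q then fps_nth F (N + 1 + q) else 0)"
  proof cases
    case 1
    then have "fps_nth (F - fps_X) i = 0" using dvd unfolding fps_X_power_dvd_iff by blast
    with 1 show ?thesis by simp
  next
    case 4
    then obtain k where k: "i = Suc (N + k)" "0 < k" "k < q"
      by (metis Suc_eq_plus1 add.commute add_Suc_right add_less_cancel_left less_imp_Suc_add
          plus_1_eq_Suc zero_less_Suc)
    then have "\<not> q dvd N + k" using N by (simp add: dvd_add_right_iff nat_dvd_not_less)
    then have "fps_nth F i = 0" using F k by (auto simp: normal_form_iff)
    with 4 N show ?thesis by simp
  qed (use N q in simp_all)
qed

text \<open>If \<open>F\<close> commutes with \<open>f\<close>, comparing the coefficients of degree \<open>N + 1 + 2q\<close> in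
  $f \circ F = F \circ f$ determines the subleading coefficient of \<open>F\<close>.\<close>

lemma commuting_second_coeff:
  fixes f F :: "'a::field fps"
  assumes f: "two_term q (q + 1) a b (f - fps_X)" and F: "two_term q (N + 1) \<chi> \<xi> (F - fps_X)"
    and q: "0 < q" "q < N" and N: "of_nat N = (of_nat q :: 'a)"
    and comm: "f oo F = F oo f"
  shows "of_nat q * a * \<xi> = \<chi> * (of_nat q * b - of_nat ((N + 1) choose 2) * a\<^sup>2)"
proof -
  have f0: "fps_nth f 0 = 0" "fps_nth F 0 = 0"
    using f F unfolding two_term_iff[OF q(1)] by (auto dest: spec[of _ 0])
  \<comment> \<open>f - X and F - X are the differences of X under f and F, and the two difference
    operators commute.\<close>
  then have eq: "compose_diff F (f - fps_X) = compose_diff f (F - fps_X)"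
    using compose_diff_commute[of F f fps_X] comm by (simp add: compose_diff_def)
  have "fps_nth (compose_diff F (f - fps_X)) (q + 1 + N + q) =
      second_coeff q N \<chi> \<xi> (q + 1) * a + of_nat (q + 1 + q) * \<chi> * b"
    using two_term_compose_diff[OF F q(1) _ f] q unfolding two_term_iff[OF q(1)] by auto
  moreover have "fps_nth (compose_diff f (F - fps_X)) (N + 1 + q + q) =
      second_coeff q q a b (N + 1) * \<chi> + of_nat (N + 1 + q) * a * \<xi>"
    using two_term_compose_diff[OF f q(1) _ F] q unfolding two_term_iff[OF q(1)] by auto
  moreover have "q + 1 + N + q = N + 1 + q + q" by simp
  ultimately have "second_coeff q N \<chi> \<xi> (q + 1) * a + of_nat (q + 1 + q) * \<chi> * b =
      second_coeff q q a b (N + 1) * \<chi> + of_nat (N + 1 + q) * a * \<xi>"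
    unfolding eq by metis
  \<comment> \<open>Since q < N, only the expansion of \<open>f\<close> carries a quadratic term.
    With N = q in the field, \<open>\<xi>\<close> and \<open>b\<close> each collect the factor
    q.\<close>
  then show ?thesis using q N by (simp add: second_coeff_def algebra_simps)
qed

section \<open>Ramification bounds and contact with the identity\<close>

definition ram_bound :: "nat \<Rightarrow> nat \<Rightarrow> nat \<Rightarrow> nat" where
  "ram_bound p q n = q * ((p ^ (n + 1) - 1) div (p - 1))"

text \<open>Powers of p are 1 modulo p - 1, so the natural number division is exact and the quotient
  is the geometric sum 1 + p + ... + p^n.\<close>

lemma geometric_div_Suc:
  assumes "p > (1::nat)"
  shows "(p ^ (Suc n + 1) - 1) div (p - 1) = p * ((p ^ (n + 1) - 1) div (p - 1)) + 1"
proof -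
  obtain t where p: "p = Suc t" using assms by (cases p) auto
  have *: "\<exists>s. p ^ k = t * s + 1" for k
  proof (induction k)
    case (Suc k)
    then obtain s where "p ^ k = t * s + 1" by blast
    then have "p ^ Suc k = t * (p * s + 1) + 1" by (simp add: p algebra_simps)
    then show ?case by blast
  qed simp
  obtain s where s: "p ^ (n + 1) = t * s + 1" using * by blast
  then have "p ^ (Suc n + 1) = t * (p * s + 1) + 1" by (simp add: p algebra_simps)
  then show ?thesis using assms s p by simp
qed

lemma ram_bound_0 [simp]: "p > 1 \<Longrightarrow> ram_bound p q 0 = q"
  by (simp add: ram_bound_def)

lemma ram_bound_Suc: "p > 1 \<Longrightarrow> ram_bound p q (Suc n) = p * ram_bound p q n + q"
  unfolding ram_bound_def geometric_div_Suc by (simp add: algebra_simps)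

lemma ram_bound_dvd: "q dvd ram_bound p q n"
  by (simp add: ram_bound_def)

lemma of_nat_ram_bound:
  assumes "p = CHAR('a::field)" "p > 1"
  shows "of_nat (ram_bound p q n) = (of_nat q :: 'a)"
proof (cases n)
  case (Suc m)
  have "of_nat p = (0 :: 'a)" using assms by simp
  then show ?thesis using assms by (simp add: Suc ram_bound_Suc)
qed (use assms in simp)

lemma ram_bound_gt:
  assumes "p > 1" "q > 0" "n > 0"
  shows "q < ram_bound p q n"
proof -
  obtain m where "n = Suc m" using assms by (cases n) auto
  moreover have "ram_bound p q k > 0" for k
    using assms by (induction k) (simp_all add: ram_bound_Suc)
  ultimately show ?thesis using assms by (simp add: ram_bound_Suc)
qed

text \<open>This is the order of (f - X)/X, whence the shift by one in the exponents; the identity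
  series satisfies it for no N.\<close>

definition contact_order :: "nat \<Rightarrow> 'a::field fps \<Rightarrow> bool" where
  "contact_order N f \<longleftrightarrow>
     fps_X ^ (N + 1) dvd f - fps_X \<and> \<not> fps_X ^ (N + 2) dvd f - fps_X"

lemma contact_order_iff:
  "contact_order N f \<longleftrightarrow>
     (\<forall>i\<le>N. fps_nth (f - fps_X) i = 0) \<and> fps_nth (f - fps_X) (N + 1) \<noteq> 0"
proof -
  have "(\<forall>i<N + 1. fps_nth (f - fps_X) i = 0) \<longleftrightarrow> (\<forall>i\<le>N. fps_nth (f - fps_X) i = 0)"
    "(\<forall>i<N + 2. fps_nth (f - fps_X) i = 0) \<longleftrightarrow>
       (\<forall>i\<le>N. fps_nth (f - fps_X) i = 0) \<and> fps_nth (f - fps_X) (N + 1) = 0"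
    by (auto simp: less_Suc_eq_le le_Suc_eq simp del: fps_sub_nth)
  then show ?thesis unfolding contact_order_def fps_X_power_dvd_iff by blast
qed

lemma two_term_contact_order:
  assumes "0 < q" "two_term q (N + 1) u v (f - fps_X)"
  shows "contact_order N f \<longleftrightarrow> u \<noteq> 0"
proof -
  have *: "fps_nth (f - fps_X) i = (if i = N + 1 then u else if i = N + 1 + q then v else 0)"
    if "i \<le> N + 1 + q" for i
    using assms(2) that unfolding two_term_iff[OF assms(1)] by blast
  have "fps_nth (f - fps_X) i = 0" if "i \<le> N" for i using *[of i] that by simp
  moreover have "fps_nth (f - fps_X) (N + 1) = u" using *[of "N + 1"] by simp
  ultimately show ?thesis unfolding contact_order_iff by blast
qed

lemma two_term_contact_order_zero:
  assumes "0 < q" "two_term q m 0 v (f - fps_X)" "N + 1 = m + q"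
  shows "contact_order N f \<longleftrightarrow> v \<noteq> 0"
proof -
  have *: "fps_nth (f - fps_X) i = (if i = m + q then v else 0)" if "i \<le> m + q" for i
    using assms(1,2) that unfolding two_term_iff[OF assms(1)] by auto
  have "fps_nth (f - fps_X) i = 0" if "i \<le> N" for i using *[of i] that assms(3) by simp
  moreover have "fps_nth (f - fps_X) (N + 1) = v" unfolding assms(3) using *[of "m + q"] by simp
  ultimately show ?thesis unfolding contact_order_iff by blast
qed

text \<open>Doubled rather than divided, since 2 may be zero.\<close>

lemma of_nat_choose_2: "2 * of_nat (m choose 2) = of_nat m * (of_nat m - 1 :: 'a::comm_ring_1)"
proof (induction m)
  case (Suc m)
  have "of_nat (Suc m choose 2) = (of_nat m + of_nat (m choose 2) :: 'a)"
    by (simp add: numeral_2_eq_2)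
  with Suc show ?case by (simp add: algebra_simps)
qed (simp add: numeral_2_eq_2)

text \<open>If q = ps, then (\<open>\<gamma>\<close>^s - 1)^p = \<open>\<gamma>\<close>^q - 1 = 0 by
  Frobenius, so \<open>\<gamma>\<close>^s = 1 with s < q, contradicting the exact order.\<close>

lemma of_nat_order_neq_0:
  fixes \<gamma> :: "'a::field"
  assumes "prime CHAR('a)" and \<gamma>: "q > 0" "\<gamma> ^ q = 1" "\<forall>m. 0 < m \<and> m < q \<longrightarrow> \<gamma> ^ m \<noteq> 1"
  shows "of_nat q \<noteq> (0::'a)"
proof
  assume "of_nat q = (0::'a)"
  then obtain s where s: "q = CHAR('a) * s" by (auto simp: of_nat_eq_0_iff_char_dvd)
  have "(\<gamma> ^ s) ^ CHAR('a) = (\<gamma> ^ s - 1) ^ CHAR('a) + 1"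
    using freshmans_dream[OF assms(1) refl, of "\<gamma> ^ s - 1" 1] by simp
  moreover have "(\<gamma> ^ s) ^ CHAR('a) = 1"
    using \<gamma>(2) by (simp add: s mult.commute flip: power_mult)
  ultimately have "\<gamma> ^ s = 1" by simp
  moreover have "0 < s" "s < q" using s \<gamma>(1) prime_gt_1_nat[OF assms(1)] by (auto intro: Nat.gr0I)
  ultimately show False using \<gamma>(3) by blast
qed

section \<open>From one iterate to its p-th power\<close>

text \<open>f^p - X is the p-fold difference of X: its coefficient in degree pN + 1 vanishes, and
  the one in degree pN + q + 1 vanishes exactly when \<open>\<kappa>\<close> does.\<close>

lemma contact_order_fps_iter_CHAR:
  fixes f :: "'a::field fps"
  assumes p: "prime p" "p = CHAR('a)" and q: "0 < q" "q \<le> N" "of_nat q \<noteq> (0::'a)"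
    and N: "of_nat N = (of_nat q :: 'a)"
    and f: "two_term q (N + 1) \<chi> \<xi> (f - fps_X)" and \<chi>: "\<chi> \<noteq> 0"
    and c0: "\<And>m. of_nat m = (0::'a) \<Longrightarrow> second_coeff q N \<chi> \<xi> m = 0"
    and c1: "\<And>m. of_nat m = (- of_nat q :: 'a) \<Longrightarrow> second_coeff q N \<chi> \<xi> m = \<kappa>"
  shows "contact_order (p * N + q) (fps_iter f p) \<longleftrightarrow> \<kappa> \<noteq> 0"
proof -
  have f0: "fps_nth f 0 = 0" using f unfolding two_term_iff[OF q(1)] by (auto dest: spec[of _ 0])
  obtain v where v: "two_term q (1 + p * N) 0 v ((compose_diff f ^^ p) fps_X)" "v = 0 \<longleftrightarrow> \<kappa> = 0"
    using two_term_compose_diff_funpow_CHAR[OF p q N f \<chi> c0 c1] by blast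
  have "fps_iter f p - fps_X = (compose_diff f ^^ p) fps_X"
    using fps_iter_CHAR[of f] p f0 by simp
  then show ?thesis
    using two_term_contact_order_zero[OF q(1), of "1 + p * N" v "fps_iter f p" "p * N + q"] v by simp
qed

text \<open>For n > 0 one has N > q, so the quadratic term is absent and \<open>\<kappa>\<close> is
  -q\<open>\<xi>\<close>. Commutation of \<open>F\<close> with \<open>f\<close> then expresses the
  vanishing of \<open>\<xi>\<close> through a and b.\<close>

lemma contact_order_step:
  fixes f :: "'a::field fps"
  assumes p: "prime p" "p = CHAR('a)" and q: "0 < q" "of_nat q \<noteq> (0::'a)"
    and f: "two_term q (q + 1) a b (f - fps_X)" and a: "a \<noteq> 0"
    and nf: "\<And>n. normal_form q 1 (fps_iter f n)" and n: "0 < n"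
    and contact: "contact_order (ram_bound p q n) (fps_iter f (p ^ n))"
  shows "contact_order (ram_bound p q (Suc n)) (fps_iter f (p ^ Suc n)) \<longleftrightarrow>
    of_nat q * b \<noteq> of_nat ((ram_bound p q n + 1) choose 2) * a\<^sup>2"
proof -
  define N where "N = ram_bound p q n"
  define F where "F = fps_iter f (p ^ n)"
  define \<chi> where "\<chi> = fps_nth F (N + 1)"
  define \<xi> where "\<xi> = fps_nth F (N + 1 + q)"
  have p1: "p > 1" using p(1) by (rule prime_gt_1_nat)
  have f0: "fps_nth f 0 = 0" using f unfolding two_term_iff[OF q(1)] by (auto dest: spec[of _ 0])
  have N: "of_nat N = (of_nat q :: 'a)" "q < N" "q dvd N"
    using of_nat_ram_bound[OF p(2) p1] ram_bound_gt[OF p1 q(1) n] by (simp_all add: N_def ram_bound_dvd)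
  have F: "two_term q (N + 1) \<chi> \<xi> (F - fps_X)"
    using contact N unfolding \<chi>_def \<xi>_def F_def N_def[symmetric] contact_order_def
    by (intro normal_form_two_term nf q) auto
  then have \<chi>: "\<chi> \<noteq> 0" using two_term_contact_order[OF q(1) F] contact by (simp add: N_def F_def)
  have "f oo F = F oo f"
    using fps_iter_commute[OF f0, of 1 "p ^ n"] by (simp only: fps_iter_1[OF f0] F_def)
  note comm = commuting_second_coeff[OF f F q(1) N(2,1) this]
  have "contact_order (p * N + q) (fps_iter F p) \<longleftrightarrow> - of_nat q * \<xi> \<noteq> 0"
    using N by (intro contact_order_fps_iter_CHAR[OF p q(1) _ q(2) N(1) F \<chi>])
      (auto simp: second_coeff_def)
  also have "fps_iter F p = fps_iter f (p ^ Suc n)"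
    using fps_iter_mult[OF f0, of "p ^ n" p] by (simp add: F_def mult.commute)
  also have "p * N + q = ram_bound p q (Suc n)" by (simp add: N_def ram_bound_Suc[OF p1])
  also have "- of_nat q * \<xi> \<noteq> 0 \<longleftrightarrow> of_nat q * a * \<xi> \<noteq> 0" using a q by simp
  also have "\<dots> \<longleftrightarrow> of_nat q * b \<noteq> of_nat ((N + 1) choose 2) * a\<^sup>2"
    unfolding comm using \<chi> by simp
  finally show ?thesis by (simp only: N_def)
qed

lemma two_neq_0_of_odd_CHAR:
  assumes "prime CHAR('a::field)" "odd CHAR('a)"
  shows "(2::'a) \<noteq> 0"
proof
  assume "(2::'a) = 0"
  then have "CHAR('a) dvd 2" using of_nat_eq_0_iff_char_dvd[of 2, where 'a = 'a] by simp
  then have "CHAR('a) = 2" using assms(1) by (metis primes_dvd_imp_eq two_is_prime_nat)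
  then show False using assms(2) by simp
qed

text \<open>Here N = q and the quadratic term is present. As 2 is invertible, the binomial
  coefficient depends only on m in the field: it is 0 at m = 0 and q(q + 1)/2 at m = -q.\<close>

lemma contact_order_first_odd:
  fixes f :: "'a::field fps"
  assumes p: "prime p" "p = CHAR('a)" "odd p" and q: "0 < q" "of_nat q \<noteq> (0::'a)"
    and f: "two_term q (q + 1) a b (f - fps_X)" and a: "a \<noteq> 0"
  shows "contact_order (ram_bound p q 1) (fps_iter f p) \<longleftrightarrow>
    of_nat q * b \<noteq> of_nat q * (of_nat q + 1) / 2 * a\<^sup>2"
proof -
  have "(2::'a) \<noteq> 0" using two_neq_0_of_odd_CHAR[where 'a = 'a] p by simp
  then have choose: "of_nat (m choose 2) = (of_nat m * (of_nat m - 1) / 2 :: 'a)" for m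
    using of_nat_choose_2[of m, where 'a = 'a] by (simp add: field_simps)
  have "contact_order (p * q + q) (fps_iter f p) \<longleftrightarrow>
      - of_nat q * b + of_nat q * (of_nat q + 1) / 2 * a\<^sup>2 \<noteq> 0"
    by (rule contact_order_fps_iter_CHAR[OF p(1,2) q(1) order_refl q(2) refl f a])
      (simp_all add: second_coeff_def choose algebra_simps)
  also have "p * q + q = ram_bound p q 1"
    using ram_bound_Suc[of p q 0] prime_gt_1_nat[OF p(1)] by simp
  finally show ?thesis by (auto simp: algebra_simps)
qed

text \<open>In characteristic 2 the binomial coefficient depends on m modulo 4 and not only on m in
  the field, so the twofold difference is computed directly. It starts in degree 2q + 1 with the
  factor q + 1 = 0.\<close>

lemma contact_order_first_even:
  fixes f :: "'a::field fps"
  assumes p: "CHAR('a) = 2" and q: "0 < q" "odd q"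
    and f: "two_term q (q + 1) a b (f - fps_X)" and a: "a \<noteq> 0"
  shows "contact_order (ram_bound 2 q 1) (fps_iter f 2) \<longleftrightarrow>
    of_nat ((q + 1) choose 2) * a\<^sup>2 + b \<noteq> 0"
proof -
  have f0: "fps_nth f 0 = 0" using f unfolding two_term_iff[OF q(1)] by (auto dest: spec[of _ 0])
  have q1: "of_nat (q + 1) = (0::'a)" using q p by (simp only: of_nat_eq_0_iff_char_dvd) simp
  then have q2: "of_nat (q + 1 + q) = (of_nat q :: 'a)" "of_nat q = (- 1 :: 'a)"
    by (simp_all only: of_nat_add[of "q + 1" q] add_0 eq_neg_iff_add_eq_0) (simp add: add.commute)
  have "fps_iter f 2 - fps_X = compose_diff f (f - fps_X)"
    using fps_iter_CHAR[of f, unfolded p, OF two_is_prime_nat f0] f0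
    by (simp add: numeral_2_eq_2 compose_diff_def)
  moreover have "two_term q (q + 1 + q) 0 (a * (of_nat ((q + 1) choose 2) * a\<^sup>2 - b)) (compose_diff f (f - fps_X))"
    using two_term_compose_diff[OF f q(1) order_refl f] unfolding second_coeff_def q1 q2
    by (simp add: algebra_simps)
  ultimately have "contact_order (3 * q) (fps_iter f 2) \<longleftrightarrow> a * (of_nat ((q + 1) choose 2) * a\<^sup>2 - b) \<noteq> 0"
    by (intro two_term_contact_order_zero[OF q(1), of "q + 1 + q"]) auto
  then show ?thesis using a p ram_bound_Suc[of 2 q 0] by (simp add: minus_CHAR_2)
qed

lemma ram_index_iff_contact_order:
  fixes h :: "'a::field fps"
  assumes "fps_nth h 0 = 0"
  shows "ram_index n h = enat N \<longleftrightarrow> contact_order N (fps_iter h (CHAR('a) ^ n))"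
  using ram_index_eq_enat_iff[OF assms] by (simp only: contact_order_def)

text \<open>For odd N the binomial coefficient has the parity of (N + 1)/2. For n > 0 the sum 1 + 2
  + ... + 2^n is 3 modulo 4, so N is 3q modulo 4 and (3q + 1)/2 = (q + 1)/2 + q. The odd summand q
  is the source of the extra excluded value 1.\<close>

lemma of_nat_choose_ram_bound_2:
  assumes "CHAR('a::field) = 2" "odd q" "0 < n"
  shows "of_nat ((ram_bound 2 q n + 1) choose 2) = (of_nat ((q + 1) div 2) - 1 :: 'a)"
proof -
  obtain s where s: "q = 2 * s + 1" using assms(2) by (elim oddE)
  obtain m where m: "n = Suc m" using assms(3) by (cases n) auto
  define w where "w = (2::nat) ^ m - 1"
  have w: "(2::nat) ^ m = w + 1" by (simp add: w_def)
  have exp: "(2::nat) ^ (n + 1) - 1 = 4 * w + 3" by (simp add: m w)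
  have "ram_bound 2 q n = (2 * s + 1) * (4 * w + 3)"
    unfolding ram_bound_def s exp by simp
  then have "ram_bound 2 q n + 1 = (2 * s + 1) * (4 * w + 3) + 1" by simp
  also have "\<dots> = 2 * (4 * s * w + 3 * s + 2 * w + 2)" by algebra
  finally have N: "ram_bound 2 q n + 1 = 2 * (4 * s * w + 3 * s + 2 * w + 2)" .
  have "(ram_bound 2 q n + 1) choose 2 =
      (4 * s * w + 3 * s + 2 * w + 2) * (2 * (4 * s * w + 3 * s + 2 * w + 1) + 1)"
  proof -
    have "(2 * (k + 1)) choose 2 = (k + 1) * (2 * k + 1)" for k :: nat
      by (simp add: choose_two mult.assoc del: mult_Suc_right mult_Suc) simp
    from this[of "4 * s * w + 3 * s + 2 * w + 1"] show ?thesis unfolding N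
      by (simp only: add.assoc one_add_one)
  qed
  then have "even (((ram_bound 2 q n + 1) choose 2) + 1 + (q + 1) div 2)"
    by (simp add: s)
  then have "of_nat (((ram_bound 2 q n + 1) choose 2) + 1 + (q + 1) div 2) = (0::'a)"
    using assms(1) by (simp only: of_nat_eq_0_iff_char_dvd)
  then have "of_nat ((ram_bound 2 q n + 1) choose 2) + (1 + of_nat ((q + 1) div 2)) = (0::'a)"
    by (simp only: of_nat_add of_nat_1 add.assoc)
  then have "of_nat ((ram_bound 2 q n + 1) choose 2) = - (1 + of_nat ((q + 1) div 2) :: 'a)"
    by (simp only: eq_neg_iff_add_eq_0)
  then show ?thesis using assms(1) by (simp add: minus_CHAR_2 uminus_CHAR_2)
qed

text \<open>The binomial coefficient is (q + 1)/2 times the odd number q.\<close>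

lemma of_nat_choose_odd_CHAR_2:
  assumes "CHAR('a::field) = 2" "odd q"
  shows "of_nat ((q + 1) choose 2) = (of_nat ((q + 1) div 2) :: 'a)"
proof -
  obtain s where s: "q = 2 * s + 1" using assms(2) by (elim oddE)
  have "(q + 1) choose 2 = (s + 1) + 2 * (s * (s + 1))"
    unfolding choose_two s by (simp add: algebra_simps)
  then have "of_nat ((q + 1) choose 2) = (of_nat (s + 1) + of_nat CHAR('a) * of_nat (s * (s + 1)) :: 'a)"
    by (simp only: assms(1) of_nat_add of_nat_mult)
  then show ?thesis by (simp add: s)
qed

section \<open>The criterion for a series in normal form\<close>

context
  fixes p q :: nat and \<gamma> :: "'a::field" and g :: "'a fps" and a b r :: 'a
  assumes p: "prime p" "p = CHAR('a)"
    and \<gamma>: "q > 0" "\<gamma> ^ q = 1" "\<forall>m. 0 < m \<and> m < q \<longrightarrow> \<gamma> ^ m \<noteq> 1"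
    and g: "normal_form q \<gamma> g"
  defines "a \<equiv> nf_coeff q g 1" and "b \<equiv> nf_coeff q g 2"
    and "r \<equiv> half_q_plus_1 q - nf_coeff q g 2 / (nf_coeff q g 1)\<^sup>2"
begin

text \<open>Dividing \<open>g\<close> by \<open>\<gamma>\<close> gives a normal form tangent to the
  identity with the same a and b; its q-th iterate equals that of \<open>g\<close> because
  \<open>\<gamma>\<close>^q = 1.\<close>

lemma
  shows normal_form_iter_q_two_term: "two_term q (q + 1) (of_nat q * a)
      (of_nat q * b + of_nat (q choose 2) * of_nat (q + 1) * a\<^sup>2) (fps_iter g q - fps_X)"
    and normal_form_iter_q_iter: "normal_form q 1 (fps_iter (fps_iter g q) n)"
proof -
  define G where "G = fps_const (inverse \<gamma>) * g"
  have \<gamma>0: "\<gamma> \<noteq> 0" using \<gamma> by (auto simp: power_0_left)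
  have G: "normal_form q 1 G" using g \<gamma>0 by (simp add: G_def normal_form_def)
  have G0: "fps_nth G 0 = 0" using G by (simp add: normal_form_def)
  have "g = fps_const \<gamma> * G" using \<gamma>0 by (simp add: G_def flip: mult.assoc)
  then have f: "fps_iter g q = fps_iter G q"
    using fps_iter_normal_form_scale[OF G \<gamma>(2), of q] \<gamma>(2) by simp
  have "two_term q (q + 1) (fps_nth G (q + 1)) (fps_nth G (q + 1 + q)) (G - fps_X)"
  proof (rule normal_form_two_term[OF G \<gamma>(1) dvd_refl \<gamma>(1)])
    have "fps_nth (G - fps_X) i = 0" if i: "i < q + 1" for i
    proof (cases "i = 0 \<or> i = 1")
      case True
      then show ?thesis using G by (auto simp: normal_form_def)
    next
      case False
      then obtain k where k: "i = Suc k" "0 < k" "k < q" using i by (cases i) auto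
      then have "\<not> q dvd k" by (simp add: nat_dvd_not_less)
      then show ?thesis using G k False by (auto simp: normal_form_iff)
    qed
    then show "fps_X ^ (q + 1) dvd G - fps_X" unfolding fps_X_power_dvd_iff by blast
  qed
  moreover have "q + 1 + q = 2 * q + 1" by simp
  then have "fps_nth G (q + 1) = a" "fps_nth G (q + 1 + q) = b"
    using g by (simp_all only:) (simp_all add: G_def a_def b_def nf_coeff_def normal_form_def divide_inverse
        mult.commute flip: One_nat_def)
  ultimately have "two_term q (q + 1) a b (G - fps_X)" by simp
  from two_term_fps_iter[OF this \<gamma>(1), of q] show "two_term q (q + 1) (of_nat q * a)
      (of_nat q * b + of_nat (q choose 2) * of_nat (q + 1) * a\<^sup>2) (fps_iter g q - fps_X)"
    unfolding f .
  show "normal_form q 1 (fps_iter (fps_iter g q) n)"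
    unfolding f fps_iter_mult[OF G0, symmetric] by (rule normal_form_fps_iter[OF \<gamma> G])
qed

lemma contact_order_normal_form: "contact_order q (fps_iter g q) \<longleftrightarrow> a \<noteq> 0"
  using two_term_contact_order[OF \<gamma>(1) normal_form_iter_q_two_term]
    of_nat_order_neq_0[OF _ \<gamma>] p by simp

text \<open>For odd p the binomial coefficient of N + 1 depends only on N = q in the field, so every
  step, the first included, imposes the same condition r nonzero.\<close>

lemma contact_order_normal_form_odd:
  assumes "odd p" and a: "a \<noteq> 0"
  shows "(\<forall>n. contact_order (ram_bound p q n) (fps_iter (fps_iter g q) (p ^ n))) \<longleftrightarrow> r \<noteq> 0"
proof -
  let ?Q = "of_nat q :: 'a" and ?f = "fps_iter g q"
  define c where "c = ?Q * b + of_nat (q choose 2) * of_nat (q + 1) * a\<^sup>2"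
  have p1: "p > 1" using p(1) by (rule prime_gt_1_nat)
  have g0: "fps_nth g 0 = 0" using g by (simp add: normal_form_def)
  have Q: "?Q \<noteq> 0" using of_nat_order_neq_0[OF _ \<gamma>] p by simp
  then have Qa: "?Q * a \<noteq> 0" using a by simp
  have two: "(2::'a) \<noteq> 0" using two_neq_0_of_odd_CHAR[where 'a = 'a] p assms by simp
  have "(4::'a) = 2 * 2" by simp
  then have four: "(4::'a) \<noteq> 0" using two by (simp only: mult_eq_0_iff) simp
  have choose: "of_nat (m choose 2) = (of_nat m * (of_nat m - 1) / 2 :: 'a)" for m
    using of_nat_choose_2[of m, where 'a = 'a] two by (simp add: field_simps)
  note f = normal_form_iter_q_two_term[folded c_def]
  have "CHAR('a) \<noteq> 2" using p assms by auto
  then have r: "r = (?Q + 1) / 2 - b / a\<^sup>2"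
    by (simp add: r_def half_q_plus_1_def a_def b_def add.commute)
  \<comment> \<open>\<open>?Q * a\<close> and \<open>c\<close> are the two coefficients of the q-th
    iterate; in this combination they reduce to a nonzero multiple of the residue.\<close>
  have "?Q * c - ?Q * (?Q + 1) / 2 * (?Q * a)\<^sup>2 = - (?Q\<^sup>2 * a\<^sup>2 * r)"
    unfolding c_def choose r using a two four by (simp add: field_simps power2_eq_square)
  then have eq: "?Q * c = ?Q * (?Q + 1) / 2 * (?Q * a)\<^sup>2 \<longleftrightarrow> r = 0"
    using Q a by (metis eq_iff_diff_eq_0 mult_eq_0_iff neg_equal_0_iff_equal power_not_zero)
  have zero: "contact_order (ram_bound p q 0) (fps_iter ?f (p ^ 0))"
    using contact_order_normal_form a p1 g0 by (simp add: fps_iter_1[simplified])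
  have one: "contact_order (ram_bound p q 1) (fps_iter ?f (p ^ 1)) \<longleftrightarrow> r \<noteq> 0"
    using contact_order_first_odd[OF p assms(1) \<gamma>(1) Q f Qa] eq by simp
  have step: "contact_order (ram_bound p q (Suc n)) (fps_iter ?f (p ^ Suc n)) \<longleftrightarrow> r \<noteq> 0"
    if "0 < n" "contact_order (ram_bound p q n) (fps_iter ?f (p ^ n))" for n
  proof -
    have "of_nat ((ram_bound p q n + 1) choose 2) = ?Q * (?Q + 1) / 2"
      unfolding choose by (simp add: of_nat_ram_bound[OF p(2) p1] algebra_simps)
    from contact_order_step[OF p \<gamma>(1) Q f Qa normal_form_iter_q_iter that, unfolded this]
    show ?thesis using eq by blast
  qed
  have "contact_order (ram_bound p q n) (fps_iter ?f (p ^ n))" if "r \<noteq> 0" for n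
  proof (induction n)
    case (Suc n)
    then show ?case using one step[of n] that by (cases "n = 0") simp_all
  qed (rule zero)
  with one show ?thesis by blast
qed

text \<open>Here q is odd, so q = 1 and q + 1 = 0 in the field and the q-th iterate has coefficients
  a and b. The first step excludes r = 0, every later one r = 1.\<close>

lemma contact_order_normal_form_even:
  assumes "p = 2" and a: "a \<noteq> 0"
  shows "(\<forall>n. contact_order (ram_bound p q n) (fps_iter (fps_iter g q) (p ^ n))) \<longleftrightarrow>
    r \<noteq> 0 \<and> r \<noteq> 1"
proof -
  let ?Q = "of_nat q :: 'a" and ?f = "fps_iter g q"
  have char: "CHAR('a) = 2" using p assms by simp
  have g0: "fps_nth g 0 = 0" using g by (simp add: normal_form_def)
  have Q: "?Q \<noteq> 0" using of_nat_order_neq_0[OF _ \<gamma>] p by simp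
  then have q: "odd q" using of_nat_eq_0_iff_char_dvd[of q, where 'a = 'a] by (simp add: char)
  have "of_nat (q + 1) = (0::'a)" using q char by (simp only: of_nat_eq_0_iff_char_dvd) simp
  moreover from this have "?Q = 1"
    using char by (simp add: add_eq_0_iff2 uminus_CHAR_2)
  ultimately have f: "two_term q (q + 1) a b (?f - fps_X)"
    using normal_form_iter_q_two_term by simp
  define h where "h = (of_nat ((q + 1) div 2) :: 'a)"
  have r: "r = h - b / a\<^sup>2"
    by (simp add: r_def half_q_plus_1_def char h_def a_def b_def)
  have zero: "contact_order (ram_bound p q 0) (fps_iter ?f (p ^ 0))"
    using contact_order_normal_form a g0 assms(1) by (simp add: fps_iter_1[simplified])
  have "h * a\<^sup>2 + b = a\<^sup>2 * r"
    using a by (simp add: r field_simps minus_CHAR_2[OF char])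
  then have one: "contact_order (ram_bound p q 1) (fps_iter ?f (p ^ 1)) \<longleftrightarrow> r \<noteq> 0"
    using contact_order_first_even[OF char \<gamma>(1) q f a,
        unfolded of_nat_choose_odd_CHAR_2[OF char q, folded h_def]] a
    by (simp add: assms(1))
  have step: "contact_order (ram_bound p q (Suc n)) (fps_iter ?f (p ^ Suc n)) \<longleftrightarrow> r \<noteq> 1"
    if "0 < n" "contact_order (ram_bound p q n) (fps_iter ?f (p ^ n))" for n
  proof -
    have "b = (h - 1) * a\<^sup>2 \<longleftrightarrow> r = 1"
      using a by (auto simp: r field_simps)
    then show ?thesis
      using contact_order_step[OF p \<gamma>(1) Q f a normal_form_iter_q_iter that, unfolded assms(1)
          of_nat_choose_ram_bound_2[OF char q that(1), folded h_def]] \<open>?Q = 1\<close>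
      by (simp add: assms(1))
  qed
  have "contact_order (ram_bound p q n) (fps_iter ?f (p ^ n))" if "r \<noteq> 0" "r \<noteq> 1" for n
  proof (induction n)
    case (Suc n)
    then show ?case using one step[of n] that by (cases "n = 0") simp_all
  qed (rule zero)
  \<comment> \<open>The levels n = 1 and n = 2 already exclude the two values.\<close>
  moreover have "r \<noteq> 0 \<and> r \<noteq> 1"
    if *: "\<forall>n. contact_order (ram_bound p q n) (fps_iter ?f (p ^ n))"
    using one step[OF zero_less_one spec[OF *, of 1]] spec[OF *, of 1] spec[OF *, of "Suc 1"]
    by blast
  ultimately show ?thesis by blast
qed

end

section \<open>Transfer to arbitrary series\<close>

theorem theoremE:
  fixes g :: "'a::field fps" and p q :: nat and \<gamma> :: 'a
  assumes "prime p" and "CHAR('a) = p"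
    and "q > 0" and "\<gamma> ^ q = 1" and "\<forall>m. 0 < m \<and> m < q \<longrightarrow> \<gamma> ^ m \<noteq> 1"
    and "fps_nth g 0 = 0" and "fps_nth g 1 = \<gamma>"
  shows "(odd p \<longrightarrow> (minimally_ramified q g \<longleftrightarrow>
              ram_index 0 (fps_iter g q) = enat q \<and> resit q g \<noteq> 0))
       \<and> (p = 2 \<longrightarrow> (minimally_ramified q g \<longleftrightarrow>
              ram_index 0 (fps_iter g q) = enat q \<and> resit q g \<noteq> 0 \<and> resit q g \<noteq> 1))"
proof (cases "ram_index 0 (fps_iter g q) = enat q")
  case False
  \<comment> \<open>Minimal ramification at level n = 0 is the condition i_0 = q, so in this case
    both sides of each equivalence fail.\<close>
  have "ram_bound p q 0 = q" using prime_gt_1_nat[OF assms(1)] by simp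
  then have "ram_index 0 (fps_iter g q) = enat q" if "minimally_ramified q g"
    using that unfolding minimally_ramified_def assms(2) ram_bound_def[symmetric] by metis
  with False show ?thesis by blast
next
  case True
  note \<gamma> = assms(3-5) and p = assms(1) assms(2)[symmetric]
  have contact_conj: "contact_order N (fps_iter (fps_iter g' q) (p ^ n)) \<longleftrightarrow>
      ram_index n (fps_iter g q) = enat N" if "fps_conjugated g g'" for g' N n
  proof -
    have "fps_nth g' 0 = 0"
      using that assms(6) by (auto simp: fps_conjugated_def fps_invertible_series_def)
    then show ?thesis
      using ram_index_conjugated_iff[OF that assms(6), of n q N]
      by (simp add: ram_index_iff_contact_order assms(2))
  qed
  \<comment> \<open>Since i_0 = q is preserved by conjugation, every normal form of \<open>g\<close>
    has nonzero a_1.\<close>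
  have coeff: "nf_coeff q g' 1 \<noteq> 0" if "fps_conjugated g g'" "normal_form q \<gamma> g'" for g'
  proof -
    have "fps_nth g' 0 = 0" using that by (simp add: normal_form_def)
    then show ?thesis
      using contact_order_normal_form[OF p \<gamma> that(2)] contact_conj[OF that(1), of q 0] True
      by (simp add: fps_iter_1[simplified])
  qed
  \<comment> \<open>\<open>R\<close> is the predicate under \<open>SOME\<close> in
    \<open>resit\<close>. Existence of a normal form makes it satisfiable, and the criterion is
    applied to the same g' that witnesses the chosen value.\<close>
  define R where "R r \<longleftrightarrow> (\<exists>g'. fps_conjugated g g' \<and> normal_form q (fps_nth g 1) g' \<and>
        nf_coeff q g' 1 \<noteq> 0 \<and>
        r = half_q_plus_1 q - nf_coeff q g' 2 / (nf_coeff q g' 1)^2)" for r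
  have "\<exists>r. R r"
    using normal_form_exists[OF \<gamma> assms(6,7)] coeff unfolding R_def assms(7) by blast
  then have "R (resit q g)" unfolding resit_def R_def[symmetric] by (rule someI_ex)
  then obtain g' where g': "fps_conjugated g g'" "normal_form q \<gamma> g'" "nf_coeff q g' 1 \<noteq> 0"
    and resit: "resit q g = half_q_plus_1 q - nf_coeff q g' 2 / (nf_coeff q g' 1)\<^sup>2"
    unfolding R_def assms(7) by blast
  have "minimally_ramified q g \<longleftrightarrow>
      (\<forall>n. contact_order (ram_bound p q n) (fps_iter (fps_iter g' q) (p ^ n)))"
    unfolding contact_conj[OF g'(1)] minimally_ramified_def assms(2) ram_bound_def ..
  then show ?thesis
    using True contact_order_normal_form_odd[OF p \<gamma> g'(2) _ g'(3)]
      contact_order_normal_form_even[OF p \<gamma> g'(2) _ g'(3)]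
    unfolding resit by blast
qed

end
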